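(* There exists an absolute constant $D$ with the following property. Let $X\prec T$ be a block subspace of Tsirelson's space $T$ and let $|\cdot|$ be an equivalent norm on $X$ such that for some $\gamma\in\Delta(X,|\cdot|)$ one has $\gamma_1=1/2$. Then $d(X,|\cdot|)\le D$.
   Context: Tsirelson's space $T$ is the completion of $c_{00}$ (finitely supported real sequences) under the norm $\|\cdot\|$ satisfying $\|x\|=\max\big(\|x\|_\infty,\ \sup\{\frac12\sum_{i=1}^n\|E_ix\|:n\in\mathbb N,\ n\le E_1<\dots<E_n\}\big)$, where the $E_i$ are finite subsets of $\mathbb N$ and $E_ix$ is the restriction of $x$ to $E_i$; $(e_i)$ is its unit vector basis. For a basic sequence $(x_i)$, $(y_i)\prec(x_i)$ means that $(y_i)$ is a (finite or infinite) block basis of $(x_i)$; $[x_i]$ is the closed linear span. $X\prec T$ means $X=[x_i]$ for some infinite block basis $(x_i)\prec(e_i)$, which is then the basis of $X$. For an equivalent norm $|\cdot|$ on a space $(X,\|\cdot\|)$, the distortion of $|\cdot|$ is $d(X,|\cdot|)=\inf_Y\sup\{|x|/|y|:x,y\in Y,\ \|x\|=\|y\|=1\}$, the infimum being over all infinite-dimensional (closed) subspaces $Y$ of $X$. For finite $F,G\subseteq\mathbb N$, $F<G$ means $\max F<\min G$ (or one is empty); $F\ge n$ means $\min F\ge n$. Schreier classes: for sets $\mathcal F,\mathcal G$ of finite subsets of $\mathbb N$, $\mathcal F[\mathcal G]=\{\bigcup_1^nG_i: n\in\mathbb N, G_1<\dots<G_n, G_i\in\mathcal G, (\min G_i)_1^n\in\mathcal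 F\}$. $\mathcal S_0=\{\{n\}:n\in\mathbb N\}\cup\{\emptyset\}$, $\mathcal S_1=\{F:\min F\ge|F|\}\cup\{\emptyset\}$, $\mathcal S_{\alpha+1}=\mathcal S_1[\mathcal S_\alpha]$, and for a limit ordinal $\alpha<\omega_1$ one fixes $\alpha_n\uparrow\alpha$ and sets $\mathcal S_\alpha=\{F:\text{for some }n,\ F\in\mathcal S_{\alpha_n}\text{ and }F\ge n\}$. A finite block sequence $(y_i)_1^k\prec(x_i)$ is $\alpha$-admissible w.r.t. $(x_i)$ if $(\min\operatorname{supp}(y_i))_{i=1}^k\in\mathcal S_\alpha$ (supports w.r.t. $(x_i)$). $\delta_\alpha((x_i),|\cdot|)$ is the supremum of $\delta\ge0$ such that $|\sum_1^ky_i|\ge\delta\sum_1^k|y_i|$ for all $(y_i)_1^k\prec(x_i)$ $\alpha$-admissible w.r.t. $(x_i)$. Under the norm $|\cdot|$, a basic sequence $(x_i)$ $\Delta$-stabilizes $\gamma=(\gamma_\alpha)_{\alpha<\omega_1}\subseteq\mathbb R$ if there exist $\varepsilon_n\downarrow0$ so that for every $\alpha<\omega_1$ there is $m\in\mathbb N$ such that for all $n\ge m$, if $(y_i)\prec(x_i)_n^\infty$ then $|\delta_\alpha((y_i),|\cdot|)-\gamma_\alpha|<\varepsilon_n$. $\Delta(X,|\cdot|)$ is the set of all $\gamma$ that are $\Delta$-stabilized under $|\cdot|$ by some block basis of the basis of $X$. *)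

theory Defs
  imports "HOL-Analysis.Analysis" "HOL-Library.Countable_Set_Type"
begin

text \<open>
  Throughout, the index set is $\{1,2,3,\dots\}$: a sequence is a function on \<^typ>\<open>nat\<close> whose
  value at \<open>0\<close> is ignored, and finite sets of indices do not contain \<open>0\<close>.
\<close>

unbundle cardinal_syntax

section \<open>Countable ordinals\<close>

text \<open>\<open>cardSuc natLeq\<close> is a well-order of order type $\omega_1$, so its field, ordered by it,
  is the set of ordinals below $\omega_1$.\<close>

typedef omega1 = "Field (cardSuc natLeq)"
proof -
  have "infinite (Field (cardSuc natLeq))"
    using cardSuc_finite[OF natLeq_Card_order] by (simp add: Field_natLeq)
  then have "Field (cardSuc natLeq) \<noteq> {}" by (rule infinite_imp_nonempty)
  then show ?thesis by blast
qed

lemma omega1_Well_order: "Well_order (cardSuc natLeq)"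
  using cardSuc_Card_order[OF natLeq_Card_order] card_order_on_well_order_on by blast

instantiation omega1 :: wellorder
begin

definition less_eq_omega1 :: "omega1 \<Rightarrow> omega1 \<Rightarrow> bool" where
  "a \<le> b \<longleftrightarrow> (Rep_omega1 a, Rep_omega1 b) \<in> cardSuc natLeq"

definition less_omega1 :: "omega1 \<Rightarrow> omega1 \<Rightarrow> bool" where
  "(a :: omega1) < b \<longleftrightarrow> a \<le> b \<and> a \<noteq> b"

instance
proof
  let ?r = "cardSuc natLeq"
  have lin: "Linear_order ?r" and wf: "wf (?r - Id)"
    using omega1_Well_order by (auto simp: well_order_on_def)
  have refl: "refl_on (Field ?r) ?r" and trans: "trans ?r" and antisym: "antisym ?r"
    and total: "total_on (Field ?r) ?r"
    using lin by (auto simp: order_on_defs)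
  fix a b c :: omega1
  show "a \<le> a"
    using refl Rep_omega1 unfolding less_eq_omega1_def refl_on_def by blast
  show 1: "a \<le> b \<Longrightarrow> b \<le> c \<Longrightarrow> a \<le> c"
    using trans unfolding less_eq_omega1_def trans_def by blast
  show 2: "a \<le> b \<Longrightarrow> b \<le> a \<Longrightarrow> a = b"
    using antisym unfolding less_eq_omega1_def antisym_def by (metis Rep_omega1_inject)
  show "a < b \<longleftrightarrow> a \<le> b \<and> \<not> b \<le> a"
    unfolding less_omega1_def using 2
    by (metis \<open>a \<le> a\<close>)
  show "a \<le> b \<or> b \<le> a"
    using total refl Rep_omega1 unfolding less_eq_omega1_def total_on_def refl_on_def by metis
  fix P :: "omega1 \<Rightarrow> bool"
  assume step: "\<And>x. (\<And>y. y < x \<Longrightarrow> P y) \<Longrightarrow> P x"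
  have "wf (inv_image (?r - Id) Rep_omega1)" using wf by (rule wf_inv_image)
  then show "P a"
  proof (induction a rule: wf_induct_rule)
    case (less x)
    show ?case
      by (rule step, rule less) (auto simp: less_omega1_def less_eq_omega1_def Rep_omega1_inject)
  qed
qed

end

lemma uncountable_omega1: "uncountable (UNIV :: omega1 set)"
proof
  assume "countable (UNIV :: omega1 set)"
  then have "countable (Rep_omega1 ` UNIV)" by (rule countable_image)
  then have "countable (Field (cardSuc natLeq))"
    using type_definition.Rep_range[OF type_definition_omega1] by simp
  then have "|Field (cardSuc natLeq)| \<le>o natLeq"
    by (simp add: countable_card_le_natLeq)
  then have "cardSuc natLeq \<le>o natLeq"
    using card_of_Field_ordIso[OF cardSuc_Card_order[OF natLeq_Card_order]]
      ordIso_ordLeq_trans ordIso_symmetric by blast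
  then show False
    using cardSuc_greater[OF natLeq_Card_order] not_ordLeq_ordLess by blast
qed

lemma countable_initial_segment_omega1: "countable {..<a :: omega1}"
proof -
  let ?r = "cardSuc natLeq"
  have "|underS ?r (Rep_omega1 a)| <o ?r"
    using card_of_underS[OF cardSuc_Card_order[OF natLeq_Card_order]] Rep_omega1 by blast
  then have "|underS ?r (Rep_omega1 a)| \<le>o natLeq"
    using cardSuc_ordLeq_ordLess[OF natLeq_Card_order card_of_Card_order] by blast
  then have "countable (underS ?r (Rep_omega1 a))"
    by (simp add: countable_card_le_natLeq)
  moreover have "Rep_omega1 ` {..<a} \<subseteq> underS ?r (Rep_omega1 a)"
    by (auto simp: less_omega1_def less_eq_omega1_def underS_def Rep_omega1_inject)
  ultimately have "countable (Rep_omega1 ` {..<a})" by (rule countable_subset[rotated])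
  then show ?thesis
    by (rule countable_image_inj_on) (simp add: inj_on_def Rep_omega1_inject)
qed

unbundle no cardinal_syntax

definition osucc :: "omega1 \<Rightarrow> omega1" where
  "osucc a = (LEAST b. a < b)"

instantiation omega1 :: "{zero, one}"
begin
definition zero_omega1 :: omega1 where "0 = (LEAST b :: omega1. True)"
definition one_omega1 :: omega1 where "1 = osucc 0"
instance ..
end

definition is_limit :: "omega1 \<Rightarrow> bool" where
  "is_limit a \<longleftrightarrow> a \<noteq> 0 \<and> (\<forall>b. a \<noteq> osucc b)"

lemma omega1_zero_le [simp]: "(0 :: omega1) \<le> a"
  unfolding zero_omega1_def by (simp add: Least_le)

lemma omega1_ex_greater: "\<exists>b. (a :: omega1) < b"
proof (rule ccontr)
  assume "\<not> ?thesis"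
  then have "UNIV = insert a {..<a}" by (auto simp: not_less order_le_less)
  then show False
    using uncountable_omega1 countable_initial_segment_omega1[of a] by (metis countable_insert)
qed

lemma less_osucc: "a < osucc a"
  unfolding osucc_def using omega1_ex_greater by (metis LeastI_ex)

lemma osucc_le_iff: "osucc a \<le> b \<longleftrightarrow> a < b"
  using less_osucc[of a] unfolding osucc_def
  by (meson Least_le less_le_trans)

lemma osucc_inject [simp]: "osucc a = osucc b \<longleftrightarrow> a = b"
  by (metis less_osucc linorder_neqE not_less osucc_le_iff)

lemma osucc_neq_zero [simp]: "osucc a \<noteq> 0"
  by (metis less_osucc not_less omega1_zero_le)

lemma omega1_cases: "a = 0 \<or> (\<exists>b. a = osucc b) \<or> is_limit a" for a :: omega1
  by (auto simp: is_limit_def)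


section \<open>Schreier families\<close>

definition set_less :: "nat set \<Rightarrow> nat set \<Rightarrow> bool" where
  "set_less F G \<longleftrightarrow> (\<forall>i\<in>F. \<forall>j\<in>G. i < j)"

definition schreier0 :: "nat set set" where
  "schreier0 = insert {} {{n} |n. 1 \<le> n}"

definition schreier1 :: "nat set set" where
  "schreier1 = insert {} {F. finite F \<and> F \<noteq> {} \<and> card F \<le> Min F}"

text \<open>The family $\mathcal F[\mathcal G]$. The \<open>G i\<close> are required to be nonempty, so that their
  minima make sense; the empty union is covered by \<open>n = 0\<close>.\<close>

definition family_comp :: "nat set set \<Rightarrow> nat set set \<Rightarrow> nat set set" where
  "family_comp \<F> \<G> = {(\<Union>i\<in>{1..n}. G i) |(n :: nat) (G :: nat \<Rightarrow> nat set).
      (\<forall>i\<in>{1..n}. G i \<in> \<G> \<and> G i \<noteq> {}) \<and>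
      (\<forall>i\<in>{1..n}. \<forall>j\<in>{1..n}. i < j \<longrightarrow> set_less (G i) (G j)) \<and>
      (\<lambda>i. Min (G i)) ` {1..n} \<in> \<F>}"

lemma family_comp_mono [mono]:
  assumes "\<And>G. P G \<longrightarrow> Q G"
  shows "F \<in> family_comp \<F> (Collect P) \<longrightarrow> F \<in> family_comp \<F> (Collect Q)"
  using assms unfolding family_comp_def by blast

text \<open>A choice of sequences $\alpha_n \uparrow \alpha$ for the limit ordinals $\alpha < \omega_1$.\<close>

definition fundamental_sequences :: "(omega1 \<Rightarrow> nat \<Rightarrow> omega1) \<Rightarrow> bool" where
  "fundamental_sequences c \<longleftrightarrow> (\<forall>a. is_limit a \<longrightarrow>
      mono_on {1..} (c a) \<and> (\<forall>n\<ge>1. c a n < a) \<and> (\<forall>b<a. \<exists>n\<ge>1. b < c a n))"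

inductive in_schreier :: "(omega1 \<Rightarrow> nat \<Rightarrow> omega1) \<Rightarrow> omega1 \<Rightarrow> nat set \<Rightarrow> bool"
  for c :: "omega1 \<Rightarrow> nat \<Rightarrow> omega1"
where
  zero: "F \<in> schreier0 \<Longrightarrow> in_schreier c 0 F"
| one: "F \<in> schreier1 \<Longrightarrow> in_schreier c 1 F"
| succ: "a \<noteq> 0 \<Longrightarrow> F \<in> family_comp schreier1 {G. in_schreier c a G} \<Longrightarrow> in_schreier c (osucc a) F"
| limit: "is_limit a \<Longrightarrow> 1 \<le> n \<Longrightarrow> in_schreier c (c a n) F \<Longrightarrow> \<forall>i\<in>F. n \<le> i \<Longrightarrow> in_schreier c a F"

definition schreier :: "(omega1 \<Rightarrow> nat \<Rightarrow> omega1) \<Rightarrow> omega1 \<Rightarrow> nat set set" where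
  "schreier c a = {F. in_schreier c a F}"

lemma omega1_distinct: "0 \<noteq> osucc a" "\<not> is_limit 0" "\<not> is_limit (osucc a)"
  by (rule osucc_neq_zero[symmetric]) (simp_all add: is_limit_def)

lemma schreier_zero:
  shows "schreier c 0 = schreier0"
proof (intro set_eqI iffI)
  fix F assume "F \<in> schreier c 0"
  then have "in_schreier c 0 F" by (simp add: schreier_def)
  then show "F \<in> schreier0"
    by cases (use omega1_distinct in \<open>simp_all add: schreier_def one_omega1_def is_limit_def\<close>)
next
  fix F assume "F \<in> schreier0"
  then show "F \<in> schreier c 0"
    unfolding schreier_def by (simp add: in_schreier.zero)
qed

lemma schreier_one:
  shows "schreier c 1 = schreier1"
proof (intro set_eqI iffI)
  fix F assume "F \<in> schreier c 1"
  then have "in_schreier c 1 F" by (simp add: schreier_def)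
  then show "F \<in> schreier1"
    by cases (use omega1_distinct in \<open>simp_all add: schreier_def one_omega1_def is_limit_def\<close>)
next
  fix F assume "F \<in> schreier1"
  then show "F \<in> schreier c 1"
    unfolding schreier_def by (simp add: in_schreier.one)
qed

lemma schreier_osucc:
  assumes "a \<noteq> 0"
  shows "schreier c (osucc a) = family_comp schreier1 (schreier c a)"
proof (intro set_eqI iffI)
  fix F assume "F \<in> schreier c (osucc a)"
  then have "in_schreier c (osucc a) F" by (simp add: schreier_def)
  then show "F \<in> family_comp schreier1 (schreier c a)"
    by cases (use omega1_distinct assms in \<open>simp_all add: schreier_def one_omega1_def is_limit_def\<close>)
next
  fix F assume "F \<in> family_comp schreier1 (schreier c a)"
  then show "F \<in> schreier c (osucc a)"
    unfolding schreier_def by (simp add: in_schreier.succ assms)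
qed

lemma schreier_limit:
  assumes "is_limit a"
  shows "schreier c a = {F. \<exists>n\<ge>1. F \<in> schreier c (c a n) \<and> (\<forall>i\<in>F. n \<le> i)}"
proof (intro set_eqI iffI)
  fix F assume "F \<in> schreier c a"
  then have "in_schreier c a F" by (simp add: schreier_def)
  then show "F \<in> {F. \<exists>n\<ge>1. F \<in> schreier c (c a n) \<and> (\<forall>i\<in>F. n \<le> i)}"
    using assms by cases (auto simp: one_omega1_def is_limit_def schreier_def)
next
  fix F assume "F \<in> {F. \<exists>n\<ge>1. F \<in> schreier c (c a n) \<and> (\<forall>i\<in>F. n \<le> i)}"
  then show "F \<in> schreier c a"
    using assms unfolding schreier_def by (blast intro: in_schreier.limit)
qed


section \<open>Tsirelson's space\<close>

definition c00 :: "(nat \<Rightarrow> real) set" where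
  "c00 = {a. finite {i. a i \<noteq> 0} \<and> a 0 = 0}"

definition restr :: "nat set \<Rightarrow> (nat \<Rightarrow> real) \<Rightarrow> nat \<Rightarrow> real" where
  "restr E a = (\<lambda>i. if i \<in> E then a i else 0)"

definition lincomb :: "(nat \<Rightarrow> 'a::real_vector) \<Rightarrow> (nat \<Rightarrow> real) \<Rightarrow> 'a" where
  "lincomb e a = (\<Sum>i | a i \<noteq> 0. a i *\<^sub>R e i)"

text \<open>The relation $n \le E_1 < \dots < E_n$. The conditions are imposed on all the \<open>E i\<close>, not only on
  consecutive ones, because some of the sets may be empty.\<close>

definition tsirelson_admissible :: "nat \<Rightarrow> (nat \<Rightarrow> nat set) \<Rightarrow> bool" where
  "tsirelson_admissible n E \<longleftrightarrow>
     (\<forall>i\<in>{1..n}. finite (E i) \<and> (\<forall>k\<in>E i. n \<le> k)) \<and>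
     (\<forall>i\<in>{1..n}. \<forall>j\<in>{1..n}. i < j \<longrightarrow> set_less (E i) (E j))"

definition tsirelson_equation :: "((nat \<Rightarrow> real) \<Rightarrow> real) \<Rightarrow> bool" where
  "tsirelson_equation p \<longleftrightarrow> (\<forall>a\<in>c00.
     p a = max (SUP i. \<bar>a i\<bar>)
               (Sup {1/2 * (\<Sum>i=1..n. p (restr (E i) a)) |n E. 1 \<le> n \<and> tsirelson_admissible n E}))"

text \<open>The Banach space \<^typ>\<open>'a\<close>, with distinguished sequence \<open>e\<close>, is Tsirelson's space with its unit
  vector basis, i.e. the completion of the space \<^const>\<open>c00\<close> under the norm defined by the implicit
  equation (that equation has only one solution among the norms on \<^const>\<open>c00\<close>): the linear map
  sending the unit vectors to \<open>e\<close> transports the norm of \<^typ>\<open>'a\<close> to that norm, and has dense range.\<close>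

definition tsirelson_space :: "(nat \<Rightarrow> 'a::banach) \<Rightarrow> bool" where
  "tsirelson_space e \<longleftrightarrow>
     tsirelson_equation (\<lambda>a. norm (lincomb e a)) \<and> closure (span (e ` {1..})) = UNIV"


section \<open>Block bases\<close>

text \<open>Meaningful for linearly independent \<open>x\<close> and \<open>v \<in> span (x ` {1..})\<close>;
  see the lemma below.\<close>

definition supp :: "(nat \<Rightarrow> 'a::real_vector) \<Rightarrow> 'a \<Rightarrow> nat set" where
  "supp x v = {i. 1 \<le> i \<and> representation (x ` {1..}) v (x i) \<noteq> 0}"

lemma supp_lincomb:
  assumes inj: "inj_on x {1..}" and ind: "independent (x ` {1..})" and a: "a \<in> c00"
  shows "supp x (lincomb x a) = {i. a i \<noteq> 0}"
proof -
  let ?S = "{i. a i \<noteq> 0}"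
  have fin: "finite ?S" and a0: "a 0 = 0"
    using a by (simp_all add: c00_def)
  have S: "?S \<subseteq> {1..}"
  proof
    fix i assume "i \<in> ?S"
    then have "i \<noteq> 0" using a0 by (metis mem_Collect_eq)
    then show "i \<in> {1..}" by simp
  qed
  have "representation (x ` {1..}) (lincomb x a) (x i) = a i" if i: "1 \<le> i" for i
  proof -
    have "representation (x ` {1..}) (lincomb x a) (x i)
        = (\<Sum>j\<in>?S. representation (x ` {1..}) (a j *\<^sub>R x j) (x i))"
      unfolding lincomb_def
    proof (subst real_vector.representation_sum[OF ind])
      fix j assume "j \<in> ?S"
      then have "x j \<in> x ` {1..}" using S by blast
      then show "a j *\<^sub>R x j \<in> span (x ` {1..})" by (intro span_scale span_base)
    qed simp
    also have "\<dots> = (\<Sum>j\<in>?S. if j = i then a j else 0)"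
    proof (rule sum.cong)
      fix j assume "j \<in> ?S"
      then have j: "j \<in> {1..}" using S by blast
      then have xj: "x j \<in> x ` {1..}" by blast
      have "representation (x ` {1..}) (a j *\<^sub>R x j) (x i)
          = a j * representation (x ` {1..}) (x j) (x i)"
        by (simp only: real_vector.representation_scale[OF ind span_base[OF xj]])
      also have "representation (x ` {1..}) (x j) (x i) = (if x i = x j then 1 else 0)"
        by (simp only: real_vector.representation_basis[OF ind xj])
      also have "x i = x j \<longleftrightarrow> j = i"
        using i inj_on_eq_iff[OF inj _ j, of i] by (metis atLeast_iff)
      finally show "representation (x ` {1..}) (a j *\<^sub>R x j) (x i) = (if j = i then a j else 0)"
        by simp
    qed simp
    also have "\<dots> = a i" using fin by simp
    finally show ?thesis .
  qed
  then have "supp x (lincomb x a) = {i. 1 \<le> i \<and> a i \<noteq> 0}"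
    unfolding supp_def by (metis (no_types, lifting))
  then show ?thesis using S by blast
qed

definition block_sequence :: "(nat \<Rightarrow> 'a::real_vector) \<Rightarrow> nat set \<Rightarrow> (nat \<Rightarrow> 'a) \<Rightarrow> bool" where
  "block_sequence x I y \<longleftrightarrow>
     (\<forall>i\<in>I. y i \<in> span (x ` {1..}) \<and> y i \<noteq> 0) \<and>
     (\<forall>i\<in>I. \<forall>j\<in>I. i < j \<longrightarrow> set_less (supp x (y i)) (supp x (y j)))"

abbreviation block_basis :: "(nat \<Rightarrow> 'a::real_vector) \<Rightarrow> (nat \<Rightarrow> 'a) \<Rightarrow> bool" where
  "block_basis x y \<equiv> block_sequence x {1..} y"

definition closed_span :: "(nat \<Rightarrow> 'a::real_normed_vector) \<Rightarrow> 'a set" where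
  "closed_span x = closure (span (x ` {1..}))"

text \<open>The sequence $(x_i)_{i=n}^\infty$, renumbered so as to start at \<open>1\<close>.\<close>

definition tail :: "(nat \<Rightarrow> 'a) \<Rightarrow> nat \<Rightarrow> nat \<Rightarrow> 'a" where
  "tail x n = (\<lambda>i. x (n + i - 1))"


section \<open>Equivalent norms, distortion and the spectrum \<open>\<Delta>\<close>\<close>

definition equivalent_norm_on :: "'a::real_normed_vector set \<Rightarrow> ('a \<Rightarrow> real) \<Rightarrow> bool" where
  "equivalent_norm_on X N \<longleftrightarrow>
     (\<forall>x\<in>X. \<forall>y\<in>X. N (x + y) \<le> N x + N y) \<and>
     (\<forall>r. \<forall>x\<in>X. N (r *\<^sub>R x) = \<bar>r\<bar> * N x) \<and>
     (\<exists>A>0. \<exists>B. \<forall>x\<in>X. A * norm x \<le> N x \<and> N x \<le> B * norm x)"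

definition infinite_dim_subspace :: "'a::real_normed_vector set \<Rightarrow> bool" where
  "infinite_dim_subspace Y \<longleftrightarrow>
     subspace Y \<and> closed Y \<and> \<not> (\<exists>B. finite B \<and> span B = Y)"

definition distortion :: "'a::real_normed_vector set \<Rightarrow> ('a \<Rightarrow> real) \<Rightarrow> real" where
  "distortion X N =
     (INF Y \<in> {Y. Y \<subseteq> X \<and> infinite_dim_subspace Y}.
        Sup {N x / N y |x y. x \<in> Y \<and> y \<in> Y \<and> norm x = 1 \<and> norm y = 1})"

definition admissible :: "nat set set \<Rightarrow> (nat \<Rightarrow> 'a::real_vector) \<Rightarrow> nat \<Rightarrow> (nat \<Rightarrow> 'a) \<Rightarrow> bool" where
  "admissible \<S> x k y \<longleftrightarrow>
     block_sequence x {1..k} y \<and> (\<lambda>i. Min (supp x (y i))) ` {1..k} \<in> \<S>"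

text \<open>$\delta_\alpha((x_i),|\cdot|)$, with \<open>\<S>\<close> in the role of $\mathcal S_\alpha$.\<close>

definition delta :: "nat set set \<Rightarrow> (nat \<Rightarrow> 'a::real_vector) \<Rightarrow> ('a \<Rightarrow> real) \<Rightarrow> real" where
  "delta \<S> x N = Sup {d. 0 \<le> d \<and>
     (\<forall>k y. admissible \<S> x k y \<longrightarrow> d * (\<Sum>i=1..k. N (y i)) \<le> N (\<Sum>i=1..k. y i))}"

text \<open>Here \<open>y\<close> ranges over infinite block bases only: for a finite \<open>y\<close> the constant
  $\delta_\alpha$ is not what is meant (for a single vector it would always be \<open>1\<close>).\<close>

definition Delta_stabilizes ::
  "(omega1 \<Rightarrow> nat \<Rightarrow> omega1) \<Rightarrow> ('a::real_vector \<Rightarrow> real) \<Rightarrow> (nat \<Rightarrow> 'a) \<Rightarrow> (omega1 \<Rightarrow> real) \<Rightarrow> bool"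
where
  "Delta_stabilizes c N x \<gamma> \<longleftrightarrow>
     (\<exists>\<epsilon>. antimono_on {1..} \<epsilon> \<and> \<epsilon> \<longlonglongrightarrow> 0 \<and>
        (\<forall>\<alpha>. \<exists>m\<ge>1. \<forall>n\<ge>m. \<forall>y. block_basis (tail x n) y \<longrightarrow>
            \<bar>delta (schreier c \<alpha>) y N - \<gamma> \<alpha>\<bar> < \<epsilon> n))"

text \<open>$\Delta(X,|\cdot|)$ for the space \<open>X\<close> with basis \<open>x\<close>.\<close>

definition Delta ::
  "(omega1 \<Rightarrow> nat \<Rightarrow> omega1) \<Rightarrow> (nat \<Rightarrow> 'a::real_vector) \<Rightarrow> ('a \<Rightarrow> real) \<Rightarrow> (omega1 \<Rightarrow> real) set"
where
  "Delta c x N = {\<gamma>. \<exists>z. block_basis x z \<and> Delta_stabilizes c N z \<gamma>}"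

end

theory Submission
  imports Defs
begin

text \<open>
  Only the lower bound $\gamma_1 \ge 1/2$ matters. Let $(z_i)$ be the stabilized block basis. Choose
  \<open>\<beta> > 0\<close> such that $|v| \le 2\beta\|v\|$ on some tail of $(z_i)$, while every tail contains vectors
  with $|w| \ge \beta\|w\|$, and choose normalized blocks $w_1 < w_2 < \dots$ of the latter kind which are
  very sparse: the \<open>z\<close>-indices occurring in $w_{i+1}$ exceed a multiple of the \<open>e\<close>-support of $w_i$.
  Sparseness makes up for the difference between admissibility with respect to $(z_i)$ (which
  controls $|\cdot|$) and with respect to $(e_i)$ (which defines $\|\cdot\|$), so that $|\cdot|$
  satisfies on $[w_i]$ all the lower estimates that are needed to bound $\|\cdot\|$ by $9|\cdot|/\beta$.
  Hence the distortion is at most 18.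
\<close>

section \<open>The Tsirelson norm on finitely supported sequences\<close>

text \<open>Unfolding the implicit equation of the Tsirelson norm costs a factor 1/2 per level, and
  the equivalent norm has to pay for each level with one use of its own lower estimate. Having
  gamma_1 = 1/2 makes the two rates agree, but only constants strictly below 1/2 are available, and
  the depth of the unfolding is unbounded, so a fixed loss per level would be fatal. Allowing the
  loss \<open>K (Suc s) / K s\<close> beyond block \<open>s\<close> makes the product of all losses
  telescope. The number of sets in an admissible family is controlled only by the end of the first
  block they meet. That block therefore cannot take part in the lower estimate and stays as a
  separate term, which gives bounds of the shape \<open>\<tau> i + K i * f {Suc i..<t}\<close>. Such
  a term is compared with the whole sum only once, at the very end. There the values of
  \<open>K\<close> are at most 3 and the comparison costs at most another 3, whence 9; the choice of
  \<beta> up to a factor 2 gives 18.\<close>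

definition bsum :: "(nat \<Rightarrow> nat \<Rightarrow> real) \<Rightarrow> nat set \<Rightarrow> nat \<Rightarrow> real" where
  "bsum b F = (\<lambda>k. \<Sum>i\<in>F. b i k)"

lemma c00_restr: "a \<in> c00 \<Longrightarrow> restr E a \<in> c00"
  unfolding c00_def restr_def by (auto elim: rev_finite_subset)

lemma c00_zero: "(\<lambda>k. 0) \<in> c00"
  unfolding c00_def by auto

lemma c00_add:
  assumes "a \<in> c00" "b \<in> c00"
  shows "(\<lambda>k. a k + b k) \<in> c00"
proof -
  have "{k. a k + b k \<noteq> 0} \<subseteq> {k. a k \<noteq> 0} \<union> {k. b k \<noteq> 0}" by auto
  then show ?thesis using assms unfolding c00_def by (auto intro: finite_subset)
qed

lemma c00_bsum: "(\<And>i. i \<in> F \<Longrightarrow> b i \<in> c00) \<Longrightarrow> bsum b F \<in> c00"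
proof (induction F rule: infinite_finite_induct)
  case (insert x F)
  have "bsum b (insert x F) = (\<lambda>k. b x k + bsum b F k)"
    using insert by (auto simp: bsum_def)
  then show ?case using insert by (simp add: c00_add)
qed (simp_all add: bsum_def c00_zero)

lemma restr_bsum: "restr E (bsum b F) = bsum (\<lambda>i. restr E (b i)) F"
  by (auto simp: restr_def bsum_def)

lemma restr_restr: "restr E (restr D a) = restr (E \<inter> D) a"
  by (auto simp: restr_def)

text \<open>Instantiated with \<open>norm (lincomb e a)\<close>. Coefficient sequences are used
  because the restrictions in the implicit equation are operations on coefficients, not on vectors
  of the space.\<close>

locale tsirelson_norm =
  fixes p :: "(nat \<Rightarrow> real) \<Rightarrow> real"
  assumes eq: "tsirelson_equation p"
    and nonneg: "a \<in> c00 \<Longrightarrow> 0 \<le> p a"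
    and zero: "p (\<lambda>k. 0) = 0"
    and triangle: "a \<in> c00 \<Longrightarrow> b \<in> c00 \<Longrightarrow> p (\<lambda>k. a k + b k) \<le> p a + p b"
begin

lemma bsum_le: "(\<And>i. i \<in> F \<Longrightarrow> b i \<in> c00) \<Longrightarrow> p (bsum b F) \<le> (\<Sum>i\<in>F. p (b i))"
proof (induction F rule: infinite_finite_induct)
  case (insert x F)
  have "bsum b (insert x F) = (\<lambda>k. b x k + bsum b F k)"
    using insert by (auto simp: bsum_def)
  then have "p (bsum b (insert x F)) \<le> p (b x) + p (bsum b F)"
    using insert.prems by (simp add: triangle c00_bsum)
  also have "\<dots> \<le> p (b x) + (\<Sum>i\<in>F. p (b i))" using insert by auto
  finally show ?case using insert by simp
qed (simp_all add: bsum_def zero)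

lemma bdd_above_abs: 
  assumes "a \<in> c00" shows "bdd_above (range (\<lambda>i. \<bar>a i\<bar>))"
proof -
  have "range (\<lambda>i. \<bar>a i\<bar>) \<subseteq> insert 0 ((\<lambda>i. \<bar>a i\<bar>) ` {i. a i \<noteq> 0})" by auto
  moreover have "finite (insert 0 ((\<lambda>i. \<bar>a i\<bar>) ` {i. a i \<noteq> 0}))"
    using assms unfolding c00_def by auto
  ultimately show ?thesis by (meson bdd_above_finite finite_subset)
qed

text \<open>Without boundedness a real supremum would not dominate its members. The crude bound by
  the norms of all coordinate parts is enough: the \<open>E i\<close> are disjoint, so each
  coordinate is used at most once.\<close>

lemma bdd_above_admissible: 
  assumes a: "a \<in> c00"
  shows "bdd_above {1/2 * (\<Sum>i=1..n. p (restr (E i) a)) |n E. 1 \<le> n \<and> tsirelson_admissible n E}"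
proof -
  let ?S = "{k. a k \<noteq> 0}"
  let ?B = "\<Sum>k\<in>?S. p (restr {k} a)"
  have fin: "finite ?S" using a by (simp add: c00_def)
  have "1/2 * (\<Sum>i=1..n. p (restr (E i) a)) \<le> ?B" if adm: "tsirelson_admissible n E" for n E
  proof -
    have le: "p (restr (E i) a) \<le> (\<Sum>k\<in>?S \<inter> E i. p (restr {k} a))" for i
    proof -
      have "restr (E i) a k = bsum (\<lambda>j. restr {j} a) (?S \<inter> E i) k" for k
      proof -
        have "bsum (\<lambda>j. restr {j} a) (?S \<inter> E i) k = (\<Sum>j\<in>?S \<inter> E i. if j = k then a j else 0)"
          unfolding bsum_def restr_def by (rule sum.cong) auto
        also have "\<dots> = restr (E i) a k" using fin by (auto simp: restr_def)
        finally show ?thesis by simp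
      qed
      then have "restr (E i) a = bsum (\<lambda>j. restr {j} a) (?S \<inter> E i)" by blast
      then show ?thesis using bsum_le[of "?S \<inter> E i" "\<lambda>j. restr {j} a"] c00_restr[OF a] by simp
    qed
    have "(\<Sum>i=1..n. p (restr (E i) a)) \<le> (\<Sum>i=1..n. \<Sum>k\<in>?S \<inter> E i. p (restr {k} a))"
      by (rule sum_mono) (rule le)
    also have "\<dots> = (\<Sum>k\<in>(\<Union>i\<in>{1..n}. ?S \<inter> E i). p (restr {k} a))"
    proof (rule sum.UNION_disjoint[symmetric])
      show "\<forall>i\<in>{1..n}. \<forall>j\<in>{1..n}. i \<noteq> j \<longrightarrow> ?S \<inter> E i \<inter> (?S \<inter> E j) = {}"
    proof (intro ballI impI)
        fix i j assume ij: "i \<in> {1..n}" "j \<in> {1..n}" "i \<noteq> j"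
        then have "set_less (E i) (E j) \<or> set_less (E j) (E i)"
          using adm unfolding tsirelson_admissible_def by (metis nat_neq_iff)
        then show "?S \<inter> E i \<inter> (?S \<inter> E j) = {}" unfolding set_less_def by blast
      qed
    qed (use fin in auto)
    also have "\<dots> \<le> ?B"
      by (rule sum_mono2) (use fin nonneg c00_restr[OF a] in auto)
    finally have "(\<Sum>i=1..n. p (restr (E i) a)) \<le> ?B" .
    moreover have "0 \<le> ?B" by (rule sum_nonneg) (use nonneg c00_restr[OF a] in auto)
    ultimately show ?thesis by linarith
  qed
  then show ?thesis by (intro bdd_aboveI[of _ ?B]) blast
qed

lemma abs_le: "a \<in> c00 \<Longrightarrow> \<bar>a i\<bar> \<le> p a"
  using eq unfolding tsirelson_equation_def
  by (metis (mono_tags, lifting) UNIV_I bdd_above_abs cSUP_upper le_max_iff_disj)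

lemma admissible_le: 
  assumes "a \<in> c00" "tsirelson_admissible n E"
  shows "1/2 * (\<Sum>i=1..n. p (restr (E i) a)) \<le> p a"
proof (cases "1 \<le> n")
  case True
  have "1/2 * (\<Sum>i=1..n. p (restr (E i) a)) \<le> 
    Sup {1/2 * (\<Sum>i=1..n. p (restr (E i) a)) |n E. 1 \<le> n \<and> tsirelson_admissible n E}"
    by (rule cSup_upper[OF _ bdd_above_admissible]) (use True assms in auto)
  then show ?thesis using eq assms(1) unfolding tsirelson_equation_def by (simp add: le_max_iff_disj)
qed (use assms nonneg in auto)

lemma le_boundI:
  assumes a: "a \<in> c00" and 1: "\<And>i. \<bar>a i\<bar> \<le> r"
    and 2: "\<And>n E. tsirelson_admissible n E \<Longrightarrow> 1/2 * (\<Sum>i=1..n. p (restr (E i) a)) \<le> r"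
  shows "p a \<le> r"
proof -
  have "(SUP i. \<bar>a i\<bar>) \<le> r" by (rule cSUP_least) (use 1 in auto)
  moreover have "Sup {1/2 * (\<Sum>i=1..n. p (restr (E i) a)) |n E. 1 \<le> n \<and> tsirelson_admissible n E} \<le> r"
  proof (rule cSup_least)
    have "tsirelson_admissible 1 (\<lambda>_. {})" by (simp add: tsirelson_admissible_def)
    then show "{1/2 * (\<Sum>i=1..n. p (restr (E i) a)) |n E. 1 \<le> n \<and> tsirelson_admissible n E} \<noteq> {}"
      by blast
  qed (use 2 in blast)
  ultimately show ?thesis using eq a unfolding tsirelson_equation_def by simp
qed

end

section \<open>Upper estimate for sums of blocks\<close>

text \<open>
  \<open>b\<close> are the (scaled) blocks and \<open>f F\<close> is, up to a factor, the equivalent norm of their sum over \<open>F\<close>.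
  As $\delta_1$ is only close to $1/2$, each use of its lower estimate loses a factor; the decreasing
  constants \<open>K\<close> absorb these losses, because the blocks involved start strictly later at each level.
\<close>

locale block_estimate = tsirelson_norm +
  fixes b :: "nat \<Rightarrow> nat \<Rightarrow> real" and A :: "nat \<Rightarrow> nat" and \<tau> :: "nat \<Rightarrow> real"
    and f :: "nat set \<Rightarrow> real" and K :: "nat \<Rightarrow> real" and Q :: "nat \<Rightarrow> nat"
  assumes b_c00: "b i \<in> c00"
    and b_supp: "b i k \<noteq> 0 \<Longrightarrow> A i \<le> k \<and> k < A (Suc i)"
    and A_mono: "mono A"
    and p_le: "p (b i) \<le> \<tau> i"
    and \<tau>_le: "\<tau> i \<le> f {i}"
    and f_nonneg: "0 \<le> f F"
    and K_ge: "2 \<le> K i"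
    and K_antimono: "antimono K"
    and Q_ge: "8 * A (Suc i) + 1 \<le> Q i"
    and family: "\<And>(X :: (nat \<times> nat) set) u v s t. finite X \<Longrightarrow>
       (\<And>x. x \<in> X \<Longrightarrow> Suc s \<le> u x \<and> v x \<le> t) \<Longrightarrow>
       disjoint_family_on (\<lambda>x. {u x..<v x}) X \<Longrightarrow> 2 * card X + 1 \<le> Q s \<Longrightarrow>
       K (Suc s) / 2 * (\<Sum>x\<in>X. f {u x..<v x}) \<le> K s * f {Suc s..<t}"
begin

lemma \<tau>_nonneg: "0 \<le> \<tau> i"
  using nonneg[OF b_c00] p_le by (meson order_trans)

lemma b_unique: "b i k \<noteq> 0 \<Longrightarrow> b j k \<noteq> 0 \<Longrightarrow> i = j"
proof (induction i j rule: linorder_wlog)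
  case (le i j)
  show ?case
  proof (rule ccontr)
    assume "i \<noteq> j"
    then have "A (Suc i) \<le> A j" using le A_mono by (auto intro: monoD)
    then show False using b_supp[of i k] b_supp[of j k] le by linarith
  qed
qed auto

lemma b_order: "b i k \<noteq> 0 \<Longrightarrow> b j l \<noteq> 0 \<Longrightarrow> k < l \<Longrightarrow> i \<le> j"
proof (rule ccontr)
  assume *: "b i k \<noteq> 0" "b j l \<noteq> 0" "k < l" "\<not> i \<le> j"
  then have "A (Suc j) \<le> A i" using A_mono by (auto intro: monoD)
  then show False using b_supp[of i k] b_supp[of j l] * by linarith
qed

lemma bsum_single: "i \<in> F \<Longrightarrow> finite F \<Longrightarrow> b i k \<noteq> 0 \<Longrightarrow> bsum b F k = b i k"
proof -
  assume *: "i \<in> F" "finite F" "b i k \<noteq> 0"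
  then have "bsum b F k = (\<Sum>j\<in>F. if j = i then b i k else 0)"
    unfolding bsum_def by (intro sum.cong refl) (metis b_unique)
  then show ?thesis using * by simp
qed

text \<open>The index \<open>i\<close> stands for the first block met by an admissible family. It
  varies with the family, and \<open>f\<close> is not assumed to decrease on passing to a
  subinterval, so all positions compete in a maximum.\<close>

definition bound :: "nat \<Rightarrow> nat \<Rightarrow> real" where
  "bound s t = Max ((\<lambda>i. \<tau> i + K i * f {Suc i..<t}) ` {s..<t})"

lemma bound_ge: "s \<le> i \<Longrightarrow> i < t \<Longrightarrow> \<tau> i + K i * f {Suc i..<t} \<le> bound s t"
  unfolding bound_def by (rule Max_ge) auto

lemma term_nonneg: "0 \<le> K i * f F"
  using K_ge[of i] f_nonneg[of F] by (intro mult_nonneg_nonneg) auto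

lemma bound_attained: "s < t \<Longrightarrow> \<exists>i. s \<le> i \<and> i < t \<and> bound s t = \<tau> i + K i * f {Suc i..<t}"
proof -
  assume "s < t"
  then have "bound s t \<in> (\<lambda>i. \<tau> i + K i * f {Suc i..<t}) ` {s..<t}"
    unfolding bound_def by (intro Max_in) auto
  then show ?thesis by auto
qed

lemma bound_nonneg: "s < t \<Longrightarrow> 0 \<le> bound s t"
  using bound_attained[of s t] \<tau>_nonneg term_nonneg by (metis add_nonneg_nonneg)

text \<open>Blocks outside the range from \<open>l\<close> to \<open>r\<close> vanish on
  \<open>D\<close>. The ends are summed over the set \<open>{l, r}\<close>, so that in the case
  \<open>l = r\<close> the block is not counted twice.\<close>

lemma restr_bsum_split:
  assumes F: "finite F" and H: "{i\<in>F. \<exists>k\<in>D. b i k \<noteq> 0} \<subseteq> {l, r} \<union> {l<..<r}"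
    and lr: "l \<in> F" "r \<in> F" "{l<..<r} \<subseteq> F"
  shows "p (restr D (bsum b F)) \<le>
    (\<Sum>i\<in>{l, r}. p (restr D (b i))) + p (restr D (bsum b {l<..<r}))"
proof -
  let ?c = "\<lambda>i. restr D (b i)"
  have "restr D (bsum b F) k = bsum ?c {l, r} k + bsum ?c {l<..<r} k" for k
  proof -
    have "restr D (bsum b F) k = (\<Sum>i\<in>F. ?c i k)"
      by (simp only: restr_bsum) (simp add: bsum_def)
    also have "\<dots> = (\<Sum>i\<in>{l, r} \<union> {l<..<r}. ?c i k)"
      by (rule sum.mono_neutral_right) (use F H lr in \<open>auto simp: restr_def\<close>)
    also have "\<dots> = (\<Sum>i\<in>{l, r}. ?c i k) + (\<Sum>i\<in>{l<..<r}. ?c i k)"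
      by (rule sum.union_disjoint) auto
    finally show ?thesis by (simp add: bsum_def)
  qed
  then have "restr D (bsum b F) = (\<lambda>k. bsum ?c {l, r} k + bsum ?c {l<..<r} k)" by blast
  then have "p (restr D (bsum b F)) \<le> p (bsum ?c {l, r}) + p (bsum ?c {l<..<r})"
    by (simp add: triangle c00_bsum c00_restr b_c00)
  also have "p (bsum ?c {l, r}) \<le> (\<Sum>i\<in>{l, r}. p (?c i))"
    by (rule bsum_le) (simp add: c00_restr b_c00)
  finally show ?thesis by (simp add: restr_bsum)
qed

lemma restr_eq_zero: "(\<And>k. k \<in> D \<Longrightarrow> a k = 0) \<Longrightarrow> restr D a = (\<lambda>k. 0)"
  by (auto simp: restr_def)

text \<open>
  Each \<open>E j\<close> cuts at most the first and the last block that it meets; the blocks in between are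
  covered by the induction hypothesis. The first block met by any \<open>E j\<close>, of index \<open>i0\<close>, is kept apart:
  the number of sets is bounded by the end of its support, and hence is small compared with the
  position of all later blocks. The blocks singled out at the next level are moved up one level.
\<close>

lemma admissible_step:
  assumes st: "s < t" and adm: "tsirelson_admissible n E"
    and IH: "\<And>l r D. s \<le> l \<Longrightarrow> Suc l < r \<Longrightarrow> r < t \<Longrightarrow>
      p (restr D (bsum b {Suc l..<r})) \<le> bound (Suc l) r"
  shows "1/2 * (\<Sum>j=1..n. p (restr (E j) (bsum b {s..<t}))) \<le> bound s t"
proof -
  let ?F = "{s..<t}"
  define H where "H j = {i\<in>?F. \<exists>k\<in>E j. b i k \<noteq> 0}" for j
  define J where "J = {j\<in>{1..n}. H j \<noteq> {}}"
  define l where "l j = Min (H j)" for j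
  define r where "r j = Max (H j)" for j
  have finH: "finite (H j)" for j by (simp add: H_def)
  have finJ: "finite J" by (simp add: J_def)
  have lH: "l j \<in> H j" and rH: "r j \<in> H j" if "j \<in> J" for j
    using that finH by (auto simp: J_def l_def r_def)
  have Hlr: "l j \<le> i" "i \<le> r j" if "i \<in> H j" for i j
    using that finH by (auto simp: l_def r_def)
  have lF: "s \<le> l j" "l j < t" and rF: "s \<le> r j" "r j < t" if "j \<in> J" for j
    using lH[OF that] rH[OF that] by (auto simp: H_def)
  have lr: "l j \<le> r j" if "j \<in> J" for j using Hlr(1)[OF rH[OF that]] .
  \<comment> \<open>Equality is possible: the last block met by one set may be the first block met
    by a later one.\<close>
  have order: "r j \<le> l j'" if jj: "j \<in> J" "j' \<in> J" "j < j'" for j j'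
  proof -
    obtain k where k: "k \<in> E j" "b (r j) k \<noteq> 0" using rH[OF jj(1)] by (auto simp: H_def)
    obtain k' where k': "k' \<in> E j'" "b (l j') k' \<noteq> 0" using lH[OF jj(2)] by (auto simp: H_def)
    have "set_less (E j) (E j')" using adm jj unfolding tsirelson_admissible_def J_def by auto
    then have "k < k'" using k k' unfolding set_less_def by blast
    then show ?thesis using b_order k k' by blast
  qed
  have zero_outside: "p (restr (E j) (bsum b ?F)) = 0" if "j \<in> {1..n}" "j \<notin> J" for j
  proof -
    have "H j = {}" using that by (auto simp: J_def)
    then have "restr (E j) (bsum b ?F) = (\<lambda>k. 0)"
      by (intro restr_eq_zero) (auto simp: H_def bsum_def intro!: sum.neutral)
    then show ?thesis by (simp add: zero)
  qed
  have sumJ: "(\<Sum>j=1..n. p (restr (E j) (bsum b ?F))) = (\<Sum>j\<in>J. p (restr (E j) (bsum b ?F)))"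
    by (rule sum.mono_neutral_right) (use zero_outside in \<open>auto simp: J_def\<close>)
  show ?thesis
  proof (cases "J = {}")
    case True
    then show ?thesis using sumJ bound_nonneg[OF st] by simp
  next
    case False
    define I where "I = l ` J \<union> r ` J"
    define i0 where "i0 = Min I"
    have finI: "finite I" using finJ by (simp add: I_def)
    have "I \<noteq> {}" using False by (simp add: I_def)
    then have i0I: "i0 \<in> I" using finI unfolding i0_def by (rule Min_in[rotated])
    have i0_le: "i0 \<le> i" if "i \<in> I" for i using finI that by (simp add: i0_def)
    have IF: "s \<le> i" "i < t" if "i \<in> I" for i using that lF rF by (auto simp: I_def)
    obtain j0 where j0: "j0 \<in> J" "i0 \<in> H j0" using i0I lH rH by (auto simp: I_def)
    then obtain k0 where k0: "k0 \<in> E j0" "b i0 k0 \<noteq> 0" by (auto simp: H_def)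
    have n_le: "n \<le> A (Suc i0)"
    proof -
      have "n \<le> k0" using adm j0 k0 unfolding tsirelson_admissible_def J_def by auto
      then show ?thesis using b_supp[OF k0(2)] by linarith
    qed
    define M where "M = {j\<in>J. Suc (l j) < r j}"
    have finM: "finite M" using finJ by (simp add: M_def)
    \<comment> \<open>The index \<open>m j\<close> at which the maximum in \<open>bound\<close> is
      attained splits the interior of the \<open>j\<close>-th range: one block and a tail
      contribute, and both are intervals to which \<open>f\<close> applies.\<close>
    have "\<forall>j\<in>M. \<exists>m. l j < m \<and> m < r j \<and>
        bound (Suc (l j)) (r j) = \<tau> m + K m * f {Suc m..<r j}"
      using bound_attained unfolding M_def by (metis (no_types, lifting) Suc_le_lessD mem_Collect_eq)
    then obtain m where m: "\<And>j. j \<in> M \<Longrightarrow> l j < m j \<and> m j < r j \<and>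
        bound (Suc (l j)) (r j) = \<tau> (m j) + K (m j) * f {Suc (m j)..<r j}"
      by metis
    have MJ: "j \<in> J" if "j \<in> M" for j using that by (simp add: M_def)
    define q where "q j = (if j \<in> M then \<tau> (m j) + K (m j) * f {Suc (m j)..<r j} else 0)" for j
    have q: "p (restr (E j) (bsum b {l j<..<r j})) \<le> q j" if "j \<in> J" for j
    proof (cases "j \<in> M")
      case True
      have "{l j<..<r j} = {Suc (l j)..<r j}" by auto
      then show ?thesis
        using IH[of "l j" "r j" "E j"] lF[OF that] rF[OF that] m[OF True] True
        by (simp add: q_def M_def)
    next
      case False
      then have "{l j<..<r j} = {}" using that by (auto simp: M_def)
      then have "restr (E j) (bsum b {l j<..<r j}) = (\<lambda>k. 0)" by (simp add: restr_def bsum_def)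
      then show ?thesis using False by (simp add: q_def zero)
    qed
    have split: "p (restr (E j) (bsum b ?F)) \<le> (\<Sum>i\<in>{l j, r j}. p (restr (E j) (b i))) + q j"
      if "j \<in> J" for j
    proof -
      have "p (restr (E j) (bsum b ?F)) \<le>
          (\<Sum>i\<in>{l j, r j}. p (restr (E j) (b i))) + p (restr (E j) (bsum b {l j<..<r j}))"
      proof (rule restr_bsum_split)
        show "{i \<in> ?F. \<exists>k\<in>E j. b i k \<noteq> 0} \<subseteq> {l j, r j} \<union> {l j<..<r j}"
          using Hlr[of _ j] unfolding H_def by fastforce
      qed (use lF[OF that] rF[OF that] in auto)
      then show ?thesis using q[OF that] by linarith
    qed
    \<comment> \<open>After exchanging the sums, all pieces of one fixed block \<open>b i\<close>
      are recombined by the lower half of the Tsirelson equation, so a block counts only once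
      however many sets cut it.\<close>
    have ends: "1/2 * (\<Sum>j\<in>J. \<Sum>i\<in>{l j, r j}. p (restr (E j) (b i))) \<le> (\<Sum>i\<in>I. \<tau> i)"
    proof -
      have pos: "0 \<le> p (restr (E j) (b i))" for i j by (simp add: nonneg c00_restr b_c00)
      have "(\<Sum>j\<in>J. \<Sum>i\<in>{l j, r j}. p (restr (E j) (b i))) \<le> (\<Sum>j\<in>J. \<Sum>i\<in>I. p (restr (E j) (b i)))"
        by (intro sum_mono sum_mono2) (use finI pos in \<open>auto simp: I_def\<close>)
      also have "\<dots> = (\<Sum>i\<in>I. \<Sum>j\<in>J. p (restr (E j) (b i)))" by (rule sum.swap)
      also have "\<dots> \<le> (\<Sum>i\<in>I. \<Sum>j=1..n. p (restr (E j) (b i)))"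
        by (intro sum_mono sum_mono2) (use pos in \<open>auto simp: J_def\<close>)
      finally have "1/2 * (\<Sum>j\<in>J. \<Sum>i\<in>{l j, r j}. p (restr (E j) (b i)))
          \<le> (\<Sum>i\<in>I. 1/2 * (\<Sum>j=1..n. p (restr (E j) (b i))))"
        unfolding sum_distrib_left[symmetric] by linarith
      also have "\<dots> \<le> (\<Sum>i\<in>I. \<tau> i)"
        by (intro sum_mono order.trans[OF admissible_le[OF b_c00 adm] p_le])
      finally show ?thesis .
    qed
    \<comment> \<open>The tags 0, 1, 2 mark the end blocks other than \<open>i0\<close>, the
      maximising blocks \<open>m j\<close>, and the tails behind them. Tagging keeps the index sets
      apart.\<close>
    define X :: "(nat \<times> nat) set" where "X = {0} \<times> (I - {i0}) \<union> {1} \<times> M \<union> {2} \<times> M"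
    define u :: "nat \<times> nat \<Rightarrow> nat" where
      "u = (\<lambda>(c, j). if c = 0 then j else if c = 1 then m j else Suc (m j))"
    define v :: "nat \<times> nat \<Rightarrow> nat" where
      "v = (\<lambda>(c, j). if c = 0 then Suc j else if c = 1 then Suc (m j) else r j)"
    have sumX: "(\<Sum>x\<in>X. f {u x..<v x}) =
        (\<Sum>i\<in>I - {i0}. f {i}) + (\<Sum>j\<in>M. f {m j}) + (\<Sum>j\<in>M. f {Suc (m j)..<r j})"
    proof -
      have "(\<Sum>x\<in>X. f {u x..<v x}) = (\<Sum>x\<in>{0} \<times> (I - {i0}). f {u x..<v x})
          + (\<Sum>x\<in>{1} \<times> M. f {u x..<v x}) + (\<Sum>x\<in>{2} \<times> M. f {u x..<v x})"
        unfolding X_def using finI finM by (subst sum.union_disjoint, auto)+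
      moreover have "(\<Sum>x\<in>{c} \<times> Z. f {u x..<v x}) = (\<Sum>j\<in>Z. f {u (c, j)..<v (c, j)})" for c Z
        by (rule sum.reindex_cong[of "Pair c"]) (auto simp: inj_on_def)
      ultimately show ?thesis by (simp add: u_def v_def)
    qed
    \<comment> \<open>Together with \<open>sep\<close> this gives disjointness of the family: by
      \<open>order\<close>, the open ranges between \<open>l j\<close> and \<open>r j\<close> are
      disjoint and contain no end block.\<close>
    have notI: "i \<notin> I" if "j \<in> M" "l j < i" "i < r j" for i j
    proof
      assume "i \<in> I"
      then obtain j' where j': "j' \<in> J" "i = l j' \<or> i = r j'" by (auto simp: I_def)
      then have "j' \<noteq> j" using that by auto
      then consider "j' < j" | "j < j'" by linarith
      then show False
        using order[of j' j] order[of j j'] j' that MJ[OF that(1)] lr[of j'] by cases auto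
    qed
    have sep: "j = j'" if "j \<in> M" "j' \<in> M" "l j < i" "i < r j" "l j' < i" "i < r j'" for i j j'
      using order[of j j'] order[of j' j] that MJ by (metis leD le_less_trans linorder_neqE_nat order.strict_trans)
    have fam: "K (Suc i0) / 2 * (\<Sum>x\<in>X. f {u x..<v x}) \<le> K i0 * f {Suc i0..<t}"
    proof (rule family)
      show "finite X" using finI finM by (simp add: X_def)
      show "Suc i0 \<le> u x \<and> v x \<le> t" if xX: "x \<in> X" for x
      proof -
        obtain c j where x: "x = (c, j)" by (cases x)
        have *: "i0 \<le> l j" "r j < t" "l j < m j" "m j < r j" if "j \<in> M" for j
          using i0_le[of "l j"] MJ[OF that] rF[of j] m[OF that] by (auto simp: I_def)
        consider "c = 0" "j \<in> I" "j \<noteq> i0" | "c = 1" "j \<in> M" | "c = 2" "j \<in> M"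
          using xX x by (auto simp: X_def)
        then show ?thesis
        proof cases
          case 1
          then show ?thesis using i0_le[of j] IF[of j] x by (auto simp: u_def v_def)
        qed (use *[of j] x in \<open>auto simp: u_def v_def\<close>)
      qed
      show "disjoint_family_on (\<lambda>x. {u x..<v x}) X"
        unfolding disjoint_family_on_def
      proof (intro ballI impI equals0I)
        fix x y i assume xy: "x \<in> X" "y \<in> X" "x \<noteq> y" and i: "i \<in> {u x..<v x} \<inter> {u y..<v y}"
        obtain c j c' j' where x: "x = (c, j)" and y: "y = (c', j')" by (cases x, cases y)
        have 0: "i = j \<and> i \<in> I" if "x = (0, j)" "x \<in> X" "i \<in> {u x..<v x}" for x j
          using that by (auto simp: X_def u_def v_def)
        have 1: "i = m j \<and> j \<in> M \<and> l j < i \<and> i < r j" if "x = (1, j)" "x \<in> X" "i \<in> {u x..<v x}" for x j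
          using that m[of j] by (auto simp: X_def u_def v_def)
        have 2: "m j < i \<and> j \<in> M \<and> l j < i \<and> i < r j" if "x = (2, j)" "x \<in> X" "i \<in> {u x..<v x}" for x j
          using that m[of j] by (auto simp: X_def u_def v_def)
        have cc: "c = 0 \<or> c = 1 \<or> c = 2" "c' = 0 \<or> c' = 1 \<or> c' = 2"
          using xy x y by (auto simp: X_def)
        show False
        proof (cases "c = 0 \<or> c' = 0")
          case True
          then show False using 0[of x j] 0[of y j'] 1[of x j] 1[of y j'] 2[of x j] 2[of y j']
              xy i cc x y notI[of j i] notI[of j' i] by auto
        next
          case False
          then have *: "j \<in> M" "l j < i" "i < r j" "j' \<in> M" "l j' < i" "i < r j'"
            using cc 1[of x j] 1[of y j'] 2[of x j] 2[of y j'] xy i x y by auto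
          then have "j = j'" by (intro sep)
          then show False using cc False 1[of x j] 1[of y j'] 2[of x j] 2[of y j'] xy i x y by auto
        qed
      qed
      have "J \<subseteq> {1..n}" by (auto simp: J_def)
      then have cJ: "card J \<le> n" using card_mono[of "{1..n}" J] by simp
      moreover have cM: "card M \<le> card J" using finJ by (auto simp: M_def intro: card_mono)
      moreover have "card (I - {i0}) \<le> 2 * card J"
      proof -
        have "card (I - {i0}) \<le> card (l ` J \<union> r ` J)"
          using finI by (intro card_mono) (auto simp: I_def)
        also have "\<dots> \<le> card (l ` J) + card (r ` J)" by (rule card_Un_le)
        also have "\<dots> \<le> 2 * card J"
          using card_image_le[OF finJ, of l] card_image_le[OF finJ, of r] by linarith
        finally show ?thesis .
      qed
      moreover have "card X \<le> card (I - {i0}) + card M + card M"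
        unfolding X_def
        by (rule order.trans[OF card_Un_le] add_mono)+ (simp_all add: card_cartesian_product)
      \<comment> \<open>Each of the at most \<open>n\<close> sets contributes at most two end blocks
        and two interior intervals; this is the origin of the 8 in \<open>Q_ge\<close>.\<close>
      ultimately have "card X \<le> 4 * n" by linarith
      then show "2 * card X + 1 \<le> Q i0" using n_le Q_ge[of i0] by linarith
    qed
    have "1/2 * (\<Sum>j\<in>J. q j) = 1/2 * (\<Sum>j\<in>M. q j)"
      using finJ by (simp add: M_def q_def sum.inter_filter[symmetric] sum.If_cases Int_def cong: sum.cong)
    also have "\<dots> \<le> K (Suc i0) / 2 * ((\<Sum>j\<in>M. f {m j}) + (\<Sum>j\<in>M. f {Suc (m j)..<r j}))"
    proof -
      have "q j \<le> K (Suc i0) * (f {m j} + f {Suc (m j)..<r j})" if "j \<in> M" for j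
      proof -
        have "i0 \<le> l j" using i0_le[of "l j"] MJ[OF that] by (auto simp: I_def)
        then have "Suc i0 \<le> m j" using m[OF that] by linarith
        then have "K (m j) \<le> K (Suc i0)" using K_antimono by (rule antimonoD[rotated])
        then have "K (m j) * f {Suc (m j)..<r j} \<le> K (Suc i0) * f {Suc (m j)..<r j}"
          using f_nonneg by (rule mult_right_mono)
        moreover have "\<tau> (m j) \<le> K (Suc i0) * f {m j}"
          using \<tau>_le[of "m j"] mult_right_mono[of 1 "K (Suc i0)" "f {m j}"] K_ge[of "Suc i0"] f_nonneg[of "{m j}"]
          by linarith
        ultimately show ?thesis using that by (simp add: q_def distrib_left)
      qed
      then have "(\<Sum>j\<in>M. q j) \<le> (\<Sum>j\<in>M. K (Suc i0) * (f {m j} + f {Suc (m j)..<r j}))"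
        by (rule sum_mono)
      then show ?thesis by (simp add: sum_distrib_left[symmetric] sum.distrib)
    qed
    finally have qs: "1/2 * (\<Sum>j\<in>J. q j) \<le> 
      K (Suc i0) / 2 * ((\<Sum>j\<in>M. f {m j}) + (\<Sum>j\<in>M. f {Suc (m j)..<r j}))" .
    \<comment> \<open>The end blocks come with coefficient 1, since \<open>ends\<close> has used up
      the factor 1/2. This is why \<open>K\<close> has to stay above 2.\<close>
    have Is: "(\<Sum>i\<in>I. \<tau> i) \<le> \<tau> i0 + K (Suc i0) / 2 * (\<Sum>i\<in>I - {i0}. f {i})"
    proof -
      have "\<tau> i \<le> K (Suc i0) / 2 * f {i}" for i
        using \<tau>_le[of i] mult_right_mono[of 1 "K (Suc i0) / 2" "f {i}"] K_ge[of "Suc i0"] f_nonneg[of "{i}"]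
        by linarith
      then have "(\<Sum>i\<in>I - {i0}. \<tau> i) \<le> (\<Sum>i\<in>I - {i0}. K (Suc i0) / 2 * f {i})"
        by (intro sum_mono)
      then show ?thesis using sum.remove[OF finI i0I, of \<tau>] by (simp add: sum_distrib_left)
    qed
    have "(\<Sum>j\<in>J. p (restr (E j) (bsum b ?F))) \<le>
       (\<Sum>j\<in>J. (\<Sum>i\<in>{l j, r j}. p (restr (E j) (b i))) + q j)"
      by (rule sum_mono) (rule split)
    then have "1/2 * (\<Sum>j\<in>J. p (restr (E j) (bsum b ?F))) \<le>
       1/2 * (\<Sum>j\<in>J. \<Sum>i\<in>{l j, r j}. p (restr (E j) (b i))) + 1/2 * (\<Sum>j\<in>J. q j)"
      by (simp add: sum.distrib)
    also have "\<dots> \<le> \<tau> i0 + K (Suc i0) / 2 * (\<Sum>i\<in>I - {i0}. f {i})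
       + K (Suc i0) / 2 * ((\<Sum>j\<in>M. f {m j}) + (\<Sum>j\<in>M. f {Suc (m j)..<r j}))"
      using ends Is qs by linarith
    also have "\<dots> = \<tau> i0 + K (Suc i0) / 2 * (\<Sum>x\<in>X. f {u x..<v x})"
      unfolding sumX by (simp add: algebra_simps)
    also have "\<dots> \<le> \<tau> i0 + K i0 * f {Suc i0..<t}" using fam by simp
    also have "\<dots> \<le> bound s t" using bound_ge IF[OF i0I] by blast
    finally show ?thesis using sumJ by simp
  qed
qed

text \<open>Induction on the length of the interval, with \<open>E\<close> arbitrary:
  \<open>admissible_step\<close> applies the hypothesis to restrictions of strictly shorter sums,
  and intersecting an admissible family with \<open>E\<close> keeps it admissible.\<close>

lemma norm_le_bound: "s < t \<Longrightarrow> p (restr E (bsum b {s..<t})) \<le> bound s t"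
proof (induction "t - s" arbitrary: s t E rule: less_induct)
  case less
  have c: "bsum b {s..<t} \<in> c00" by (simp add: c00_bsum b_c00)
  show ?case
  proof (rule le_boundI)
    show "restr E (bsum b {s..<t}) \<in> c00" using c by (rule c00_restr)
    show "\<bar>restr E (bsum b {s..<t}) k\<bar> \<le> bound s t" for k
    proof (cases "restr E (bsum b {s..<t}) k = 0")
      case True
      then show ?thesis using bound_nonneg less by simp
    next
      case False
      then have nz: "(\<Sum>i\<in>{s..<t}. b i k) \<noteq> 0" by (auto simp: restr_def bsum_def split: if_splits)
      then obtain i where i: "i \<in> {s..<t}" "b i k \<noteq> 0" by (meson sum.neutral)
      have "\<bar>restr E (bsum b {s..<t}) k\<bar> \<le> \<bar>bsum b {s..<t} k\<bar>" by (simp add: restr_def)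
      also have "\<dots> = \<bar>b i k\<bar>" using bsum_single[OF i(1) _ i(2)] by simp
      also have "\<dots> \<le> \<tau> i" using abs_le[OF b_c00] p_le by (rule order_trans)
      also have "\<dots> \<le> \<tau> i + K i * f {Suc i..<t}" using term_nonneg by simp
      also have "\<dots> \<le> bound s t" using i bound_ge by simp
      finally show ?thesis .
    qed
    fix n D assume adm: "tsirelson_admissible n D"
    have "tsirelson_admissible n (\<lambda>j. D j \<inter> E)"
      using adm unfolding tsirelson_admissible_def set_less_def by (meson IntD1 finite_Int)
    then have "1/2 * (\<Sum>j=1..n. p (restr (D j \<inter> E) (bsum b {s..<t}))) \<le> bound s t"
      by (rule admissible_step[OF less.prems]) (rule less.hyps, linarith+)
    then show "1/2 * (\<Sum>j=1..n. p (restr (D j) (restr E (bsum b {s..<t})))) \<le> bound s t"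
      by (simp add: restr_restr)
  qed
qed

end

text \<open>
  Admissible families in the definition of $\delta_\alpha$ have to exhaust the vector, so the gaps between
  the intervals are filled: the intervals are among the fibres of the monotone function that counts
  the end points passed.
\<close>

lemma sum_disjoint_intervals_le:
  fixes u v :: "'x \<Rightarrow> nat" and g :: "nat set \<Rightarrow> real"
  assumes X: "finite X" "\<And>x. x \<in> X \<Longrightarrow> lo \<le> u x \<and> v x \<le> t"
    and disj: "disjoint_family_on (\<lambda>x. {u x..<v x}) X"
    and g: "\<And>F. 0 \<le> g F" "g {} = 0"
    and fibres: "\<And>key :: nat \<Rightarrow> nat. mono key \<Longrightarrow> card (key ` {lo..<t}) \<le> 2 * card X + 1 \<Longrightarrow>
       (\<Sum>m\<in>key ` {lo..<t}. g {i\<in>{lo..<t}. key i = m}) \<le> r"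
  shows "(\<Sum>x\<in>X. g {u x..<v x}) \<le> r"
proof -
  \<comment> \<open>Empty intervals contribute \<open>g {} = 0\<close>, but their end points would
    only cut other fibres apart.\<close>
  define Y where "Y = {x\<in>X. u x < v x}"
  define key :: "nat \<Rightarrow> nat" where "key i = (\<Sum>x\<in>Y. of_bool (u x \<le> i) + of_bool (v x \<le> i))" for i
  have finY: "finite Y" using X by (simp add: Y_def)
  have mono: "mono key"
    unfolding key_def by (intro monoI sum_mono add_mono) auto
  have "key i \<le> 2 * card Y" for i
    unfolding key_def using sum_bounded_above[of Y _ "2::nat"] by (simp add: mult.commute)
  moreover have "card Y \<le> card X" using X by (auto simp: Y_def intro: card_mono)
  ultimately have "key ` {lo..<t} \<subseteq> {0..2 * card X}" by (meson atLeastAtMost_iff image_subsetI le0 mult_le_mono2 order_trans)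
  then have "card (key ` {lo..<t}) \<le> card {0..2 * card X}" by (intro card_mono) auto
  then have card: "card (key ` {lo..<t}) \<le> 2 * card X + 1" by simp
  \<comment> \<open>Passing any end point increases \<open>key\<close>, so a fibre cannot extend
    beyond its interval; \<open>const\<close> gives the converse, as no other interval begins or
    ends in the interior.\<close>
  have strict: "key i < key j" if ij: "i \<le> j" and x: "x \<in> Y"
    "(i < u x \<and> u x \<le> j) \<or> (i < v x \<and> v x \<le> j)" for i j x
    unfolding key_def
  proof (rule sum_strict_mono_ex1[OF finY])
    show "\<forall>x\<in>Y. (of_bool (u x \<le> i) + of_bool (v x \<le> i) :: nat) \<le> of_bool (u x \<le> j) + of_bool (v x \<le> j)"
      using ij by auto
    show "\<exists>x\<in>Y. (of_bool (u x \<le> i) + of_bool (v x \<le> i) :: nat) < of_bool (u x \<le> j) + of_bool (v x \<le> j)"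
      using x ij by (intro bexI[of _ x]) auto
  qed
  have const: "key i = key (u x)" if x: "x \<in> Y" and i: "u x \<le> i" "i < v x" for i x
    unfolding key_def
  proof (rule sum.cong)
    fix y assume y: "y \<in> Y"
    show "(of_bool (u y \<le> i) + of_bool (v y \<le> i) :: nat) = of_bool (u y \<le> u x) + of_bool (v y \<le> u x)"
    proof (cases "y = x")
      case False
      then have "{u x..<v x} \<inter> {u y..<v y} = {}"
        using disj x y unfolding disjoint_family_on_def Y_def by blast
      then have "v x \<le> u y \<or> v y \<le> u x" using x y unfolding Y_def by auto
      then show ?thesis using x y i unfolding Y_def by auto
    qed (use i in auto)
  qed simp
  have fibre: "{i\<in>{lo..<t}. key i = key (u x)} = {u x..<v x}" if x: "x \<in> Y" for x
  proof (intro set_eqI iffI)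
    fix i assume "i \<in> {i\<in>{lo..<t}. key i = key (u x)}"
    then have i: "key i = key (u x)" by simp
    have "u x < v x" using x by (simp add: Y_def)
    have "key i < key (u x)" if "i < u x"
      by (rule strict[OF _ x]) (use that in auto)
    moreover have "key (u x) < key i" if "v x \<le> i"
      by (rule strict[OF _ x]) (use that \<open>u x < v x\<close> in auto)
    ultimately have "\<not> i < u x" "\<not> v x \<le> i" using i by auto
    then show "i \<in> {u x..<v x}" by simp
  next
    fix i assume "i \<in> {u x..<v x}"
    then have "u x \<le> i" "i < v x" by auto
    moreover have "lo \<le> u x" "v x \<le> t" using X(2)[of x] x by (auto simp: Y_def)
    ultimately show "i \<in> {i\<in>{lo..<t}. key i = key (u x)}"
      by (simp add: const[OF x, of i])
  qed
  have inj: "inj_on (\<lambda>x. key (u x)) Y"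
  proof (rule inj_onI)
    fix x y assume xy: "x \<in> Y" "y \<in> Y" "key (u x) = key (u y)"
    have "{u x..<v x} = {u y..<v y}"
      using fibre[OF xy(1)] fibre[OF xy(2)] unfolding xy(3) by (rule trans[OF sym])
    then have "{u x..<v x} \<inter> {u y..<v y} \<noteq> {}" using xy by (auto simp: Y_def)
    then show "x = y" using disj xy unfolding disjoint_family_on_def Y_def by blast
  qed
  have "(\<Sum>x\<in>X. g {u x..<v x}) = (\<Sum>x\<in>Y. g {u x..<v x})"
  proof (rule sum.mono_neutral_right)
    show "\<forall>x\<in>X - Y. g {u x..<v x} = 0"
    proof
      fix x assume "x \<in> X - Y"
      then have "{u x..<v x} = {}" by (auto simp: Y_def)
      then show "g {u x..<v x} = 0" using g(2) by simp
    qed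
  qed (use X in \<open>auto simp: Y_def\<close>)
  also have "\<dots> = (\<Sum>x\<in>Y. g {i\<in>{lo..<t}. key i = key (u x)})"
    by (rule sum.cong) (simp_all only: fibre)
  also have "\<dots> = (\<Sum>m\<in>(\<lambda>x. key (u x)) ` Y. g {i\<in>{lo..<t}. key i = m})"
    by (simp add: sum.reindex[OF inj])
  also have "\<dots> \<le> (\<Sum>m\<in>key ` {lo..<t}. g {i\<in>{lo..<t}. key i = m})"
  proof (rule sum_mono2)
    show "(\<lambda>x. key (u x)) ` Y \<subseteq> key ` {lo..<t}"
      using X(2) by (force simp: Y_def)
  qed (use g in auto)
  also have "\<dots> \<le> r" using fibres[OF mono card] .
  finally show ?thesis .
qed

section \<open>Block bases and independence\<close>

lemma lincomb_eq_sum: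
  assumes "finite S" "\<And>i. i \<notin> S \<Longrightarrow> a i = 0"
  shows "lincomb e a = (\<Sum>i\<in>S. a i *\<^sub>R e i)"
  unfolding lincomb_def by (rule sum.mono_neutral_left) (use assms in auto)

lemma lincomb_add:
  assumes "a \<in> c00" "b \<in> c00"
  shows "lincomb e (\<lambda>k. a k + b k) = lincomb e a + lincomb e b"
proof -
  let ?S = "{i. a i \<noteq> 0} \<union> {i. b i \<noteq> 0}"
  have S: "finite ?S" using assms by (simp add: c00_def)
  show ?thesis
    using lincomb_eq_sum[OF S, of a e] lincomb_eq_sum[OF S, of b e]
      lincomb_eq_sum[OF S, of "\<lambda>k. a k + b k" e]
    by (simp add: scaleR_add_left sum.distrib)
qed

lemma lincomb_zero: "lincomb e (\<lambda>k. 0) = 0"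
  by (simp add: lincomb_def)

lemma lincomb_scale: "lincomb e (\<lambda>k. r * a k) = r *\<^sub>R lincomb e a"
  by (cases "r = 0") (simp_all add: lincomb_def scaleR_sum_right)

lemma lincomb_bsum:
  "(\<And>i. i \<in> F \<Longrightarrow> b i \<in> c00) \<Longrightarrow> lincomb e (bsum b F) = (\<Sum>i\<in>F. lincomb e (b i))"
proof (induction F rule: infinite_finite_induct)
  case (insert x F)
  have "bsum b (insert x F) = (\<lambda>k. b x k + bsum b F k)"
    using insert by (auto simp: bsum_def)
  then show ?case using insert by (simp add: lincomb_add c00_bsum)
qed (simp_all add: bsum_def lincomb_zero)

lemma c00_scale: "a \<in> c00 \<Longrightarrow> (\<lambda>k. r * a k) \<in> c00"
  by (auto simp: c00_def elim: rev_finite_subset)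

lemma span_image_lincomb:
  assumes "v \<in> span (e ` A)" "0 \<notin> A"
  obtains a where "a \<in> c00" "v = lincomb e a" "\<And>k. a k \<noteq> 0 \<Longrightarrow> k \<in> A"
proof -
  have "\<exists>a. a \<in> c00 \<and> v = lincomb e a \<and> (\<forall>k. a k \<noteq> 0 \<longrightarrow> k \<in> A)"
    using assms(1)
  proof (induction rule: span_induct_alt)
    case base
    show ?case using c00_zero lincomb_zero by (intro exI[of _ "\<lambda>k. 0"]) auto
  next
    case (step r x y)
    then obtain a i where a: "a \<in> c00" "y = lincomb e a" "\<forall>k. a k \<noteq> 0 \<longrightarrow> k \<in> A" and i: "x = e i" "i \<in> A"
      by blast
    let ?d = "\<lambda>k. if k = i then r else 0"
    have d: "?d \<in> c00" using i assms(2) by (auto simp: c00_def)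
    have "lincomb e ?d = r *\<^sub>R e i"
      by (subst lincomb_eq_sum[of "{i}"]) auto
    then have "r *\<^sub>R x + y = lincomb e (\<lambda>k. ?d k + a k)"
      unfolding lincomb_add[OF d a(1)] using a i by simp
    then show ?case using c00_add[OF d a(1)] a(3) i(2)
      by (intro exI[of _ "\<lambda>k. ?d k + a k"]) auto
  qed
  then show ?thesis using that by blast
qed

text \<open>Injectivity has to be added because \<open>independent\<close> sees only the range,
  while \<open>supp\<close> identifies an index with its vector.\<close>

definition independent_sequence :: "(nat \<Rightarrow> 'a::real_vector) \<Rightarrow> bool" where
  "independent_sequence x \<longleftrightarrow> inj_on x {1..} \<and> independent (x ` {1..})"

lemma independent_sequenceI:
  assumes *: "\<And>a k. a \<in> c00 \<Longrightarrow> lincomb x a = 0 \<Longrightarrow> a k = 0"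
  shows "independent_sequence x"
proof -
  have inj: "inj_on x {1..}"
  proof (rule inj_onI, rule ccontr)
    fix i j assume ij: "i \<in> {1..}" "j \<in> {1..}" "x i = x j" "i \<noteq> j"
    let ?a = "\<lambda>k. if k = i then 1 else if k = j then -1 else 0 :: real"
    have "?a \<in> c00" using ij by (auto simp: c00_def intro: finite_subset[of _ "{i, j}"])
    moreover have "lincomb x ?a = 0"
      using ij by (subst lincomb_eq_sum[of "{i, j}"]) auto
    ultimately show False using *[of ?a i] by simp
  qed
  have "independent (x ` {1..})"
    unfolding independent_explicit_module
  proof (intro allI impI)
    fix t u v assume t: "finite t" "t \<subseteq> x ` {1..}" "(\<Sum>v\<in>t. u v *\<^sub>R v) = 0" "v \<in> t"
    then obtain I where I: "I \<subseteq> {1..}" "t = x ` I" by (meson subset_imageE)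
    then have injI: "inj_on x I" using inj inj_on_subset by blast
    have finI: "finite I" using t I injI finite_imageD by blast
    let ?a = "\<lambda>k. if k \<in> I then u (x k) else 0"
    have "?a \<in> c00" using finI I by (auto simp: c00_def)
    moreover have "lincomb x ?a = (\<Sum>k\<in>I. u (x k) *\<^sub>R x k)"
      by (subst lincomb_eq_sum[of I]) (use finI in auto)
    moreover have "\<dots> = 0" using t(3) unfolding I(2) by (simp add: sum.reindex[OF injI])
    ultimately have "lincomb x ?a = 0" by simp
    from *[OF \<open>?a \<in> c00\<close> this] have 0: "?a k = 0" for k .
    obtain k where "k \<in> I" "v = x k" using t(4) I by blast
    then show "u v = 0" using 0[of k] by simp
  qed
  then show ?thesis using inj by (simp add: independent_sequence_def)
qed

lemma independent_sequence_supp_lincomb: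
  "independent_sequence x \<Longrightarrow> a \<in> c00 \<Longrightarrow> supp x (lincomb x a) = {i. a i \<noteq> 0}"
  by (simp add: independent_sequence_def supp_lincomb)

lemma supp_facts:
  assumes x: "independent_sequence x" and v: "v \<in> span (x ` A)" "0 \<notin> A"
  shows "supp x v \<subseteq> A" "finite (supp x v)" "v \<noteq> 0 \<Longrightarrow> supp x v \<noteq> {}"
    "v \<in> span (x ` supp x v)"
proof -
  obtain a where a: "a \<in> c00" "v = lincomb x a" "\<And>k. a k \<noteq> 0 \<Longrightarrow> k \<in> A"
    using span_image_lincomb[OF v] by blast
  have s: "supp x v = {i. a i \<noteq> 0}" using independent_sequence_supp_lincomb[OF x a(1)] a(2) by simp
  then show "supp x v \<subseteq> A" "finite (supp x v)" using a by (auto simp: c00_def)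
  show "v \<in> span (x ` supp x v)"
    unfolding s unfolding a(2) lincomb_def by (intro span_sum span_scale span_base) auto
  then show "supp x v \<noteq> {}" if "v \<noteq> 0" using that by auto
qed

lemma independent_sequenceD:
  assumes x: "independent_sequence x" and a: "a \<in> c00" "lincomb x a = 0"
  shows "a k = 0"
proof -
  have "supp x 0 = {}" using supp_facts(1)[OF x span_zero, of "{}"] by simp
  then show ?thesis using independent_sequence_supp_lincomb[OF x a(1)] a(2) by auto
qed

text \<open>A block basis together with cut points \<open>\<alpha>\<close>. Recording consecutive
  intervals instead of exact supports turns passing to a further block basis into composition of the
  cut functions.\<close>

definition interval_blocks :: "(nat \<Rightarrow> 'a::real_vector) \<Rightarrow> (nat \<Rightarrow> nat) \<Rightarrow> (nat \<Rightarrow> 'a) \<Rightarrow> bool" where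
  "interval_blocks x \<alpha> y \<longleftrightarrow> strict_mono \<alpha> \<and>
     (\<forall>i\<ge>1. y i \<noteq> 0 \<and> y i \<in> span (x ` {\<alpha> i..<\<alpha> (Suc i)}))"

lemma interval_blocks_pos: "interval_blocks x \<alpha> y \<Longrightarrow> 1 \<le> i \<Longrightarrow> i \<le> \<alpha> i"
  by (simp add: interval_blocks_def strict_mono_imp_increasing)

lemma block_basis_interval_blocks:
  assumes x: "independent_sequence x" and y: "block_basis x y"
  obtains \<alpha> where "interval_blocks x \<alpha> y"
proof -
  \<comment> \<open>The value 0 at index 0 keeps \<open>\<alpha>\<close> strictly increasing,
    because all supports lie in \<open>{1..}\<close>.\<close>
  define \<alpha> where "\<alpha> i = (if i = 0 then 0 else Min (supp x (y i)))" for i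
  have y1: "y i \<noteq> 0" "y i \<in> span (x ` {1..})" if "1 \<le> i" for i
    using y that by (auto simp: block_sequence_def)
  have less: "set_less (supp x (y i)) (supp x (y j))" if "1 \<le> i" "i < j" for i j
    using y that by (auto simp: block_sequence_def)
  have s: "supp x (y i) \<subseteq> {1..}" "finite (supp x (y i))" "supp x (y i) \<noteq> {}"
    "y i \<in> span (x ` supp x (y i))" if "1 \<le> i" for i
    using supp_facts[OF x y1(2)[OF that]] y1(1)[OF that] by simp_all
  have \<alpha>_in: "\<alpha> i \<in> supp x (y i)" if "1 \<le> i" for i
    using Min_in[OF s(2,3)[OF that]] that by (simp add: \<alpha>_def)
  have "\<alpha> i < \<alpha> (Suc i)" for i
  proof (cases "i = 0")
    case True
    then show ?thesis using \<alpha>_in[of "Suc i"] s(1)[of "Suc i"] by (auto simp: \<alpha>_def[of 0])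
  next
    case False
    then show ?thesis
      using \<alpha>_in[of i] \<alpha>_in[of "Suc i"] less[of i "Suc i"] by (auto simp: set_less_def)
  qed
  then have "strict_mono \<alpha>" by (simp add: strict_mono_Suc_iff)
  moreover have "y i \<in> span (x ` {\<alpha> i..<\<alpha> (Suc i)})" if i: "1 \<le> i" for i
  proof -
    have "supp x (y i) \<subseteq> {\<alpha> i..<\<alpha> (Suc i)}"
    proof
      fix k assume k: "k \<in> supp x (y i)"
      have "\<alpha> i \<le> k" using i k s(2)[OF i] by (simp add: \<alpha>_def)
      moreover have "k < \<alpha> (Suc i)"
        using less[OF i, of "Suc i"] \<alpha>_in[of "Suc i"] k by (auto simp: set_less_def)
      ultimately show "k \<in> {\<alpha> i..<\<alpha> (Suc i)}" by simp
    qed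
    then show ?thesis using s(4)[OF i] by (meson image_mono span_mono subsetD)
  qed
  ultimately show ?thesis using y1 by (intro that[of \<alpha>]) (auto simp: interval_blocks_def)
qed

lemma interval_blocks_span:
  assumes y: "interval_blocks x \<alpha> y" and l: "1 \<le> l"
  shows "span (y ` {l..<r}) \<subseteq> span (x ` {\<alpha> l..<\<alpha> r})"
proof (rule span_minimal)
  have sm: "strict_mono \<alpha>" using y by (simp add: interval_blocks_def)
  show "y ` {l..<r} \<subseteq> span (x ` {\<alpha> l..<\<alpha> r})"
  proof
    fix v assume "v \<in> y ` {l..<r}"
    then obtain i where i: "l \<le> i" "i < r" "v = y i" by auto
    then have "\<alpha> l \<le> \<alpha> i" "\<alpha> (Suc i) \<le> \<alpha> r"
      using sm by (auto simp: strict_mono_less_eq)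
    then have "x ` {\<alpha> i..<\<alpha> (Suc i)} \<subseteq> x ` {\<alpha> l..<\<alpha> r}" by (intro image_mono) auto
    moreover have "v \<in> span (x ` {\<alpha> i..<\<alpha> (Suc i)})" using y i l by (auto simp: interval_blocks_def)
    ultimately show "v \<in> span (x ` {\<alpha> l..<\<alpha> r})" by (meson span_mono subsetD)
  qed
qed (rule subspace_span)

lemma interval_blocks_trans:
  assumes y: "interval_blocks x \<alpha> y" and z: "interval_blocks y \<beta> z"
  shows "interval_blocks x (\<alpha> \<circ> \<beta>) z"
  unfolding interval_blocks_def
proof (intro conjI allI impI)
  show "strict_mono (\<alpha> \<circ> \<beta>)" using y z by (simp add: interval_blocks_def strict_mono_o)
  fix i :: nat assume i: "1 \<le> i"
  show "z i \<noteq> 0" using z i by (simp add: interval_blocks_def)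
  have "z i \<in> span (y ` {\<beta> i..<\<beta> (Suc i)})" using z i by (simp add: interval_blocks_def)
  moreover have "1 \<le> \<beta> i" using interval_blocks_pos[OF z i] i by linarith
  ultimately show "z i \<in> span (x ` {(\<alpha> \<circ> \<beta>) i..<(\<alpha> \<circ> \<beta>) (Suc i)})"
    using interval_blocks_span[OF y, of "\<beta> i" "\<beta> (Suc i)"] by auto
qed

lemma interval_blocks_coefficients:
  assumes y: "interval_blocks x \<alpha> y"
  obtains \<zeta> where "\<And>i. 1 \<le> i \<Longrightarrow> \<zeta> i \<in> c00" "\<And>i. 1 \<le> i \<Longrightarrow> y i = lincomb x (\<zeta> i)"
    "\<And>i k. 1 \<le> i \<Longrightarrow> \<zeta> i k \<noteq> 0 \<Longrightarrow> \<alpha> i \<le> k \<and> k < \<alpha> (Suc i)"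
proof -
  have "\<exists>a. a \<in> c00 \<and> y i = lincomb x a \<and> (\<forall>k. a k \<noteq> 0 \<longrightarrow> \<alpha> i \<le> k \<and> k < \<alpha> (Suc i))"
    if i: "1 \<le> i" for i
  proof -
    have "y i \<in> span (x ` {\<alpha> i..<\<alpha> (Suc i)})" "0 \<notin> {\<alpha> i..<\<alpha> (Suc i)}"
      using y interval_blocks_pos[OF y i] i by (auto simp: interval_blocks_def)
    from span_image_lincomb[OF this] show ?thesis by (metis atLeastLessThan_iff)
  qed
  then show ?thesis using that by metis
qed

lemma strict_mono_interval_unique:
  assumes "strict_mono (\<alpha> :: nat \<Rightarrow> nat)" "\<alpha> i \<le> k" "k < \<alpha> (Suc i)" "\<alpha> j \<le> k" "k < \<alpha> (Suc j)"
  shows "i = j"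
  using assms by (metis le_less_trans less_Suc_eq_le order.antisym strict_mono_less)

lemma interval_blocks_independent:
  assumes x: "independent_sequence x" and y: "interval_blocks x \<alpha> y"
  shows "independent_sequence y"
proof (rule independent_sequenceI)
  fix a k assume a: "a \<in> c00" "lincomb y a = 0"
  obtain \<zeta> where \<zeta>: "\<And>i. 1 \<le> i \<Longrightarrow> \<zeta> i \<in> c00" "\<And>i. 1 \<le> i \<Longrightarrow> y i = lincomb x (\<zeta> i)"
    "\<And>i k. 1 \<le> i \<Longrightarrow> \<zeta> i k \<noteq> 0 \<Longrightarrow> \<alpha> i \<le> k \<and> k < \<alpha> (Suc i)"
    using interval_blocks_coefficients[OF y] by blast
  let ?S = "{i. a i \<noteq> 0}" and ?b = "\<lambda>i k. a i * \<zeta> i k"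
  have S: "finite ?S" "\<And>i. i \<in> ?S \<Longrightarrow> 1 \<le> i"
    using a(1) by (auto simp: c00_def Suc_le_eq intro: Nat.gr0I)
  have b: "?b i \<in> c00" if "i \<in> ?S" for i using \<zeta>(1) S(2)[OF that] by (intro c00_scale)
  have "lincomb x (bsum ?b ?S) = (\<Sum>i\<in>?S. a i *\<^sub>R lincomb x (\<zeta> i))"
    using b by (subst lincomb_bsum) (auto simp: lincomb_scale)
  also have "\<dots> = lincomb y a"
    unfolding lincomb_def[of y] by (rule sum.cong) (use \<zeta>(2) S(2) in auto)
  finally have "lincomb x (bsum ?b ?S) = 0" using a(2) by simp
  moreover have "bsum ?b ?S \<in> c00" using b by (rule c00_bsum)
  ultimately have zero: "bsum ?b ?S l = 0" for l using independent_sequenceD[OF x] by blast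
  show "a k = 0"
  proof (rule ccontr)
    assume ak: "a k \<noteq> 0"
    then have k: "1 \<le> k" using S by auto
    have "y k \<noteq> 0" using y k by (simp add: interval_blocks_def)
    \<comment> \<open>At a coordinate \<open>l\<close> in the support of \<open>y k\<close> all
      other blocks vanish, so the \<open>l\<close>-th coefficient of the combination is the nonzero
      \<open>a k * \<zeta> k l\<close>.\<close>
    then obtain l where l: "\<zeta> k l \<noteq> 0" using \<zeta>(2)[OF k] by (metis lincomb_zero ext)
    have "?b i l = 0" if "i \<in> ?S" "i \<noteq> k" for i
      using strict_mono_interval_unique[of \<alpha> i l k] \<zeta>(3)[OF k l] \<zeta>(3)[OF S(2)[OF that(1)], of l] that(2) y
      by (auto simp: interval_blocks_def)
    then have "bsum ?b ?S l = (\<Sum>i\<in>?S. if i = k then ?b k l else 0)"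
      unfolding bsum_def by (intro sum.cong) auto
    then show False using zero[of l] S(1) ak l by simp
  qed
qed

section \<open>The unit vector basis of Tsirelson's space\<close>

lemma tsirelson_norm_lincomb:
  assumes "tsirelson_space e"
  shows "tsirelson_norm (\<lambda>a. norm (lincomb e a))"
proof
  show "tsirelson_equation (\<lambda>a. norm (lincomb e a))" using assms by (simp add: tsirelson_space_def)
qed (simp_all add: lincomb_add lincomb_zero norm_triangle_ineq)

text \<open>The norm dominates every coordinate, so a vanishing combination has only zero
  coefficients.\<close>

lemma tsirelson_independent:
  assumes "tsirelson_space e"
  shows "independent_sequence e"
proof (rule independent_sequenceI)
  fix a k assume "a \<in> c00" "lincomb e a = 0"
  then show "a k = 0"
    using tsirelson_norm.abs_le[OF tsirelson_norm_lincomb[OF assms], of a k] by simp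
qed

section \<open>Lower estimates from the constant $\delta_1$\<close>

lemma tail_image: 
  assumes "1 \<le> n" "n \<le> a"
  shows "z ` {a..<b} \<subseteq> tail z n ` {Suc a - n..<Suc b - n}"
proof
  fix v assume "v \<in> z ` {a..<b}"
  then obtain i where i: "a \<le> i" "i < b" "v = z i" by auto
  \<comment> \<open>The tail is renumbered from 1, so \<open>z i\<close> has index
    \<open>i - n + 1\<close> in it.\<close>
  then have "v = tail z n (Suc i - n)" using assms by (simp add: tail_def)
  moreover have "Suc i - n \<in> {Suc a - n..<Suc b - n}" using i assms by auto
  ultimately show "v \<in> tail z n ` {Suc a - n..<Suc b - n}" by blast
qed

lemma tail_independent:
  assumes "independent_sequence z" "1 \<le> n"
  shows "independent_sequence (tail z n)"
proof -
  have "tail z n ` {1..} \<subseteq> z ` {1..}" using assms by (auto simp: tail_def)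
  moreover have "inj_on (tail z n) {1..}"
  proof (rule inj_onI)
    fix i j assume "i \<in> {1..}" "j \<in> {1..}" "tail z n i = tail z n j"
    moreover have "inj_on z {1..}" using assms by (simp add: independent_sequence_def)
    ultimately have "n + i - 1 = n + j - 1" using assms(2)
      by (intro inj_onD[of z "{1..}"]) (auto simp: tail_def)
    then show "i = j" using assms(2) by linarith
  qed
  ultimately show ?thesis
    using assms independent_mono by (auto simp: independent_sequence_def)
qed

text \<open>Lets the stabilization hypothesis be applied to a tail regarded as a block basis of
  itself.\<close>

lemma block_basis_refl:
  assumes "independent_sequence x"
  shows "block_basis x x"
proof -
  have *: "supp x (x i) \<subseteq> {i}" "x i \<noteq> 0" if "1 \<le> i" for i
  proof -
    show "supp x (x i) \<subseteq> {i}" using that by (intro supp_facts(1)[OF assms] span_base) auto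
    have "x i \<in> x ` {1..}" using that by simp
    then show "x i \<noteq> 0" using assms dependent_zero unfolding independent_sequence_def by metis
  qed
  show ?thesis
    unfolding block_sequence_def set_less_def
  proof (intro conjI ballI impI)
    fix i j k l :: nat
    assume "i \<in> {1..}" "j \<in> {1..}" "i < j" "k \<in> supp x (x i)" "l \<in> supp x (x j)"
    then show "k < l" using *(1)[of i] *(1)[of j] by auto
  qed (use * in \<open>auto intro: span_base\<close>)
qed

text \<open>Grouping the \<open>b i\<close> by a monotone \<open>key\<close> yields successive
  vectors, at most \<open>q\<close> of them. Since \<open>n + q \<le> L i\<close>, their supports in
  the tail lie beyond \<open>q\<close>, so the family is Schreier admissible whatever the groups
  are.\<close>

lemma delta_lower_estimate:
  fixes z :: "nat \<Rightarrow> 'a::real_vector"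
  assumes z: "independent_sequence z" and N: "\<And>v. v \<in> span (z ` {1..}) \<Longrightarrow> 0 \<le> N v" "N 0 = 0"
    and c: "c < delta schreier1 (tail z n) N" and n: "1 \<le> n"
    and b: "\<And>i. i \<in> G \<Longrightarrow> b i \<in> span (z ` {L i..<L (Suc i)})" and L: "mono L"
    and q: "\<And>i. i \<in> G \<Longrightarrow> n + q \<le> L i"
    and G: "finite G" and key: "mono (key :: nat \<Rightarrow> nat)" and card: "card (key ` G) \<le> q"
  shows "c * (\<Sum>m\<in>key ` G. N (\<Sum>i\<in>{i\<in>G. key i = m}. b i)) \<le> N (\<Sum>i\<in>G. b i)"
proof -
  let ?t = "tail z n"
  have t: "independent_sequence ?t" using z n by (rule tail_independent)
  define U where "U m = (\<Sum>i\<in>{i\<in>G. key i = m}. b i)" for m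
  define S where "S m = (\<Union>i\<in>{i\<in>G. key i = m}. {Suc (L i) - n..<Suc (L (Suc i)) - n})" for m
  have S_ge: "q < k" if "k \<in> S m" for k m
    using that q unfolding S_def by fastforce
  have S_less: "k < k'" if k: "k \<in> S m" "k' \<in> S m'" "m < m'" for k k' m m'
  proof -
    obtain i i' where i: "i \<in> G" "key i = m" "k < Suc (L (Suc i)) - n"
      "i' \<in> G" "key i' = m'" "Suc (L i') - n \<le> k'"
      using k(1,2) by (auto simp: S_def)
    then have "\<not> i' \<le> i" using key k(3) by (metis monoD leD)
    then have "L (Suc i) \<le> L i'" using L by (auto intro: monoD)
    then show ?thesis using i by linarith
  qed
  have bt: "b i \<in> span (?t ` {Suc (L i) - n..<Suc (L (Suc i)) - n})" if "i \<in> G" for i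
  proof -
    have "n \<le> L i" using q[OF that] by simp
    then show ?thesis using b[OF that] span_mono[OF tail_image[OF n]] by blast
  qed
  have U: "U m \<in> span (?t ` S m)" for m
    unfolding U_def
  proof (rule span_sum)
    fix i assume i: "i \<in> {i\<in>G. key i = m}"
    have "?t ` {Suc (L i) - n..<Suc (L (Suc i)) - n} \<subseteq> ?t ` S m"
      using i unfolding S_def by (intro image_mono) blast
    then show "b i \<in> span (?t ` S m)" using bt[of i] i span_mono by blast
  qed
  have S0: "0 \<notin> S m" for m using S_ge by fastforce
  have supp: "supp ?t (U m) \<subseteq> S m" "finite (supp ?t (U m))"
    "U m \<noteq> 0 \<Longrightarrow> supp ?t (U m) \<noteq> {}" for m
    using supp_facts[OF t U S0] by simp_all
  have U1: "U m \<in> span (?t ` {1..})" for m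
  proof -
    have "S m \<subseteq> {1..}" using S_ge[of _ m] by fastforce
    then show ?thesis using U span_mono[OF image_mono] by blast
  qed
  \<comment> \<open>Groups may sum to 0, which a block sequence forbids. The others are enumerated
    increasingly by \<open>h\<close>, starting at 0, hence the shift in \<open>y\<close>.\<close>
  define M where "M = {m\<in>key ` G. U m \<noteq> 0}"
  have finM: "finite M" using G by (simp add: M_def)
  obtain h where h: "bij_betw h {..<card M} M" "strict_mono_on {..<card M} h"
    using ex_bij_betw_strict_mono_card[OF finM] .
  define y where "y j = U (h (j - 1))" for j
  have bij: "bij_betw (\<lambda>j. h (j - 1)) {1..card M} M"
  proof -
    have "bij_betw (\<lambda>j. j - 1) {1..card M} {..<card M}"
      by (rule bij_betwI[where g = Suc]) auto
    from bij_betw_trans[OF this h(1)] show ?thesis by (simp add: comp_def)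
  qed
  then have hM: "h (j - 1) \<in> M" if "j \<in> {1..card M}" for j using that bij_betwE by blast
  have adm: "admissible schreier1 ?t (card M) y"
    unfolding admissible_def block_sequence_def
  proof (intro conjI ballI impI)
    fix i assume i: "i \<in> {1..card M}"
    show "y i \<in> span (?t ` {1..})" "y i \<noteq> 0"
      using hM[OF i] U1 by (auto simp: y_def M_def)
  next
    fix i j assume ij: "i \<in> {1..card M}" "j \<in> {1..card M}" "i < j"
    then have "i - 1 \<in> {..<card M}" "j - 1 \<in> {..<card M}" "i - 1 < j - 1" by auto
    then have "h (i - 1) < h (j - 1)" using strict_mono_onD[OF h(2)] by blast
    then show "set_less (supp ?t (y i)) (supp ?t (y j))"
      unfolding set_less_def y_def using S_less supp(1) by blast
  next
    let ?F = "(\<lambda>i. Min (supp ?t (y i))) ` {1..card M}"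
    show "?F \<in> schreier1"
    proof (cases "card M = 0")
      case True
      then show ?thesis by (simp add: schreier1_def)
    next
      case False
      then have ne: "?F \<noteq> {}" by simp
      have "q \<le> Min (supp ?t (y i))" if "i \<in> {1..card M}" for i
      proof -
        have "y i \<noteq> 0" using hM[OF that] by (auto simp: y_def M_def)
        then have "Min (supp ?t (y i)) \<in> supp ?t (y i)"
          using supp(2,3) unfolding y_def by (intro Min_in)
        then have "Min (supp ?t (y i)) \<in> S (h (i - 1))" using supp(1) unfolding y_def by blast
        then show ?thesis using S_ge less_imp_le by blast
      qed
      then have "q \<le> Min ?F" using ne by (subst Min_ge_iff) auto
      moreover have "card ?F \<le> card M" using card_image_le[of "{1..card M}"] by simp
      moreover have "card M \<le> q"
        using card_mono[of "key ` G" M] G card by (auto simp: M_def)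
      ultimately show ?thesis using ne by (auto simp: schreier1_def)
    qed
  qed
  let ?D = "{d. 0 \<le> d \<and> (\<forall>k y. admissible schreier1 ?t k y \<longrightarrow>
      d * (\<Sum>i=1..k. N (y i)) \<le> N (\<Sum>i=1..k. y i))}"
  have Nt: "0 \<le> N v" if "v \<in> span (?t ` {1..})" for v
  proof -
    have "?t ` {1..} \<subseteq> z ` {1..}" using n by (auto simp: tail_def)
    then show ?thesis using N(1) that span_mono by blast
  qed
  \<comment> \<open>Nonemptiness of \<open>?D\<close> allows a constant \<open>d > c\<close> to be
    extracted from the supremum.\<close>
  have "0 \<in> ?D"
    by (auto simp: admissible_def block_sequence_def intro!: Nt span_sum)
  then obtain d where d: "d \<in> ?D" "c < d"
    using less_cSupD[of ?D c] c unfolding delta_def by blast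
  have "(\<Sum>m\<in>key ` G. N (U m)) = (\<Sum>m\<in>M. N (U m))"
    by (rule sum.mono_neutral_right) (use G N(2) in \<open>auto simp: M_def\<close>)
  also have "\<dots> = (\<Sum>j=1..card M. N (y j))"
    unfolding y_def by (rule sum.reindex_bij_betw[OF bij, symmetric])
  finally have 1: "(\<Sum>m\<in>key ` G. N (U m)) = (\<Sum>j=1..card M. N (y j))" .
  have "(\<Sum>i\<in>G. b i) = (\<Sum>m\<in>key ` G. U m)"
    unfolding U_def using sum.image_gen[OF G] by blast
  also have "\<dots> = (\<Sum>m\<in>M. U m)"
    by (rule sum.mono_neutral_right) (use G in \<open>auto simp: M_def\<close>)
  also have "\<dots> = (\<Sum>j=1..card M. y j)"
    unfolding y_def by (rule sum.reindex_bij_betw[OF bij, symmetric])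
  finally have 2: "(\<Sum>i\<in>G. b i) = (\<Sum>j=1..card M. y j)" .
  have "c * (\<Sum>m\<in>key ` G. N (U m)) \<le> d * (\<Sum>m\<in>key ` G. N (U m))"
    using d(2) U1 Nt by (intro mult_right_mono sum_nonneg) auto
  also have "\<dots> \<le> N (\<Sum>i\<in>G. b i)" using d(1) adm unfolding 1 2 by blast
  finally show ?thesis by (simp add: U_def)
qed

text \<open>Any sequence decreasing strictly from \<open>3\<close> and staying above \<open>2\<close> would do.\<close>

definition slack :: "nat \<Rightarrow> real" where
  "slack s = 2 + 1 / (real s + 1)"

lemma slack_bounds: "2 < slack s" "slack s \<le> 3"
  by (simp_all add: slack_def field_simps)

lemma slack_less: "slack (Suc s) < slack s"
  by (simp add: slack_def field_simps)

lemma antimono_slack: "antimono slack"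
  using slack_less less_imp_le by (intro decseq_SucI) blast

text \<open>The gap condition lets blocks after \<open>s\<close> begin, in \<open>z\<close>-indices,
  beyond a multiple of the end \<open>\<alpha> (R s)\<close> of the \<open>e\<close>-support of
  \<open>w s\<close>. Any family whose size is limited by that end is then admissible for
  \<open>z\<close>, and \<open>block_estimate\<close> applies to the coefficients of
  \<open>v\<close>.\<close>

lemma norm_le_on_blocks:
  fixes e :: "nat \<Rightarrow> 'a::banach"
  assumes e: "tsirelson_space e" and z: "interval_blocks e \<alpha> z"
    and N: "\<And>v. v \<in> span (z ` {1..}) \<Longrightarrow> 0 \<le> N v"
      "\<And>r v. v \<in> span (z ` {1..}) \<Longrightarrow> N (r *\<^sub>R v) = \<bar>r\<bar> * N v"
    and \<beta>: "0 < \<beta>"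
    and LR: "\<And>i. L i \<le> R i" "\<And>i. R i \<le> L (Suc i)"
    and w: "\<And>i. 1 \<le> i \<Longrightarrow> w i \<in> span (z ` {L i..<R i})"
      "\<And>i. 1 \<le> i \<Longrightarrow> norm (w i) = 1" "\<And>i. 1 \<le> i \<Longrightarrow> \<beta> \<le> N (w i)"
    and n: "\<And>s. \<exists>n\<ge>1. slack (Suc s) / (2 * slack s) < delta schreier1 (tail z n) N \<and>
        n + (8 * \<alpha> (R s) + 9) \<le> L (Suc s)"
    and v: "v \<in> span (w ` {1..})"
  shows "\<beta> * norm v \<le> 9 * N v"
proof -
  have indep: "independent_sequence z"
    using interval_blocks_independent[OF tsirelson_independent[OF e] z] .
  have sm\<alpha>: "strict_mono \<alpha>" using z by (simp add: interval_blocks_def)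
  have monoL: "mono L" using LR by (intro incseq_SucI) (meson order_trans)
  have monoR: "mono R" using LR by (intro incseq_SucI) (meson order_trans)
  have L1: "1 \<le> L i" if "1 \<le> i" for i
  proof -
    have "1 \<le> L (Suc 0)" using n[of 0] by auto
    also have "\<dots> \<le> L i" using monoL that by (auto intro: monoD)
    finally show ?thesis .
  qed
  obtain a where a: "a \<in> c00" "v = lincomb w a" "\<And>k. a k \<noteq> 0 \<Longrightarrow> k \<in> {1..}"
    using span_image_lincomb[OF v] by auto
  have a0: "a 0 = 0" using a(3)[of 0] by auto
  have "\<exists>x. x \<in> c00 \<and> w i = lincomb e x \<and> (\<forall>k. x k \<noteq> 0 \<longrightarrow> \<alpha> (L i) \<le> k \<and> k < \<alpha> (R i))"
    if i: "1 \<le> i" for i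
  proof -
    have "w i \<in> span (e ` {\<alpha> (L i)..<\<alpha> (R i)})"
      using w(1)[OF i] interval_blocks_span[OF z L1[OF i]] by blast
    moreover have "0 \<notin> {\<alpha> (L i)..<\<alpha> (R i)}"
      using interval_blocks_pos[OF z L1[OF i]] L1[OF i] by auto
    ultimately show ?thesis by (metis span_image_lincomb atLeastLessThan_iff)
  qed
  then obtain \<omega> where \<omega>: "\<And>i. 1 \<le> i \<Longrightarrow> \<omega> i \<in> c00" "\<And>i. 1 \<le> i \<Longrightarrow> w i = lincomb e (\<omega> i)"
    "\<And>i k. 1 \<le> i \<Longrightarrow> \<omega> i k \<noteq> 0 \<Longrightarrow> \<alpha> (L i) \<le> k \<and> k < \<alpha> (R i)"
    by metis
  define b where "b i k = (if i = 0 then 0 else a i * \<omega> i k)" for i k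
  define A where "A i = (if i = 0 then 0 else \<alpha> (R (i - 1)))" for i
  define u where "u i = lincomb e (b i)" for i
  define f where "f F = N (\<Sum>i\<in>F. u i) / \<beta>" for F
  \<comment> \<open>The constant 9 also leaves room for the two intervals of the final comparison,
    which need \<open>5 \<le> Q 0\<close>.\<close>
  define Q where "Q i = 8 * \<alpha> (R i) + 9" for i
  have b0: "b 0 = (\<lambda>k. 0)" and b_pos: "1 \<le> i \<Longrightarrow> b i = (\<lambda>k. a i * \<omega> i k)" for i
    by (auto simp: b_def)
  have bc: "b i \<in> c00" for i
    using b0 b_pos[of i] \<omega>(1)[of i] c00_zero c00_scale by (cases "i = 0") auto
  have u: "u i = a i *\<^sub>R w i" for i
    using b0 b_pos[of i] \<omega>(2)[of i] a0 by (cases "i = 0") (auto simp: u_def lincomb_zero lincomb_scale)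
  have uz: "u i \<in> span (z ` {L i..<R i})" for i
    using w(1)[of i] a0 by (cases "i = 0") (auto simp: u intro: span_scale span_zero)
  have wz1: "span (z ` {L i..<R i}) \<subseteq> span (z ` {1..})" if "1 \<le> i" for i
    using L1[OF that] by (intro span_mono image_mono) auto
  have uz1: "u i \<in> span (z ` {1..})" for i
    using uz[of i] wz1[of i] a0 by (cases "i = 0") (auto simp: u span_zero)
  have N0: "N 0 = 0" using N(2)[of 0 0] by (simp add: span_zero)
  have f0: "0 \<le> f F" for F
    unfolding f_def using \<beta> by (intro divide_nonneg_pos N(1) span_sum uz1)
  have fam: "slack (Suc s) / 2 * (\<Sum>x\<in>X. f {l x..<r x}) \<le> slack s * f {Suc s..<t}"
    if X: "finite X" "\<And>x. x \<in> X \<Longrightarrow> Suc s \<le> l x \<and> r x \<le> t"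
      "disjoint_family_on (\<lambda>x. {l x..<r x}) X" "2 * card X + 1 \<le> Q s"
    for X :: "(nat \<times> nat) set" and l r s t
  proof -
    \<comment> \<open>With this \<open>c\<close>, the inequality \<open>c * sum \<le> f\<close>
      becomes the required one on multiplying by \<open>slack s\<close>.\<close>
    define c where "c = slack (Suc s) / (2 * slack s)"
    have c: "0 < c" using slack_bounds(1)[of s] slack_bounds(1)[of "Suc s"] by (simp add: c_def)
    obtain n where n: "1 \<le> n" "c < delta schreier1 (tail z n) N" "n + Q s \<le> L (Suc s)"
      using n[of s] unfolding c_def Q_def by blast
    have "(\<Sum>x\<in>X. f {l x..<r x}) \<le> f {Suc s..<t} / c"
    proof (rule sum_disjoint_intervals_le[OF X(1,2,3)])
      show "f {} = 0" by (simp add: f_def N0)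
      fix key :: "nat \<Rightarrow> nat"
      assume key: "mono key" "card (key ` {Suc s..<t}) \<le> 2 * card X + 1"
      let ?G = "{Suc s..<t}"
      have "c * (\<Sum>m\<in>key ` ?G. N (\<Sum>i\<in>{i\<in>?G. key i = m}. u i)) \<le> N (\<Sum>i\<in>?G. u i)"
      proof (rule delta_lower_estimate[OF indep N(1) N0 n(2,1) _ monoL])
        show "u i \<in> span (z ` {L i..<L (Suc i)})" for i
        proof -
          have "z ` {L i..<R i} \<subseteq> z ` {L i..<L (Suc i)}" using LR(2)[of i] by (intro image_mono) auto
          then show ?thesis using uz[of i] span_mono by blast
        qed
        show "n + Q s \<le> L i" if "i \<in> ?G" for i
        proof -
          have "L (Suc s) \<le> L i" using that monoL by (auto intro: monoD)
          then show ?thesis using n(3) by linarith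
        qed
        show "card (key ` ?G) \<le> Q s" using key(2) X(4) by linarith
      qed (use key in auto)
      then show "(\<Sum>m\<in>key ` ?G. f {i\<in>?G. key i = m}) \<le> f ?G / c"
        unfolding f_def sum_divide_distrib[symmetric] using c \<beta>
        by (simp add: field_simps)
    qed (simp_all add: f0)
    then have "c * (\<Sum>x\<in>X. f {l x..<r x}) \<le> f {Suc s..<t}" using c by (simp add: field_simps)
    then show ?thesis using slack_bounds(1)[of s] by (simp add: c_def field_simps)
  qed
  interpret block_estimate "\<lambda>a. norm (lincomb e a)" b A "\<lambda>i. \<bar>a i\<bar>" f slack Q
  proof (intro block_estimate.intro tsirelson_norm_lincomb[OF e] block_estimate_axioms.intro)
    fix i k
    show "b i \<in> c00" by (rule bc)
    show "A i \<le> k \<and> k < A (Suc i)" if "b i k \<noteq> 0"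
    proof -
      have i: "1 \<le> i" "\<omega> i k \<noteq> 0" using that by (auto simp: b_def split: if_splits)
      have "\<alpha> (R (i - 1)) \<le> \<alpha> (L i)"
        using LR(2)[of "i - 1"] i sm\<alpha> by (simp add: strict_mono_less_eq)
      then show ?thesis using \<omega>(3)[OF i] i by (simp add: A_def)
    qed
    show "mono A"
    proof (rule incseq_SucI)
      fix i
      have "R (i - 1) \<le> R i" using monoR by (auto intro: monoD)
      then show "A i \<le> A (Suc i)" using sm\<alpha> by (auto simp: A_def strict_mono_less_eq)
    qed
    show "norm (lincomb e (b i)) \<le> \<bar>a i\<bar>"
      using w(2)[of i] a0 u[of i] by (cases "i = 0") (auto simp: u_def)
    show "\<bar>a i\<bar> \<le> f {i}"
    proof (cases "i = 0")
      case True
      then show ?thesis using a0 f0[of "{i}"] by simp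
    next
      case False
      then have i: "1 \<le> i" by simp
      then have "N (u i) = \<bar>a i\<bar> * N (w i)" using N(2) w(1) wz1 unfolding u by blast
      then have "\<bar>a i\<bar> * \<beta> \<le> N (u i)" using w(3)[OF i] by (simp add: mult_left_mono)
      then show ?thesis using \<beta> by (simp add: f_def field_simps)
    qed
    show "2 \<le> slack i" using slack_bounds(1)[of i] by simp
    show "8 * A (Suc i) + 1 \<le> Q i" by (simp add: A_def Q_def)
  qed (fact f0 antimono_slack fam)+
  have "finite {i. a i \<noteq> 0}" using a(1) by (simp add: c00_def)
  then obtain t0 where t0: "\<And>i. a i \<noteq> 0 \<Longrightarrow> i < t0"
    unfolding finite_nat_set_iff_bounded by blast
  obtain t where t: "\<And>i. a i \<noteq> 0 \<Longrightarrow> i < t" and t2: "1 < t"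
    using that[of "max 2 t0"] t0 by fastforce
  have v_sum: "v = (\<Sum>i\<in>{1..<t}. u i)"
    unfolding a(2) u by (rule lincomb_eq_sum) (use t a(3) in force)+
  then have vf: "N v = \<beta> * f {1..<t}" using \<beta> by (simp add: f_def)
  have "v = lincomb e (restr UNIV (bsum b {1..<t}))"
    using v_sum bc by (simp add: restr_def lincomb_bsum u_def)
  then have "norm v \<le> bound 1 t" using norm_le_bound[OF t2, of UNIV] by simp
  moreover obtain i where i: "1 \<le> i" "i < t" "bound 1 t = \<bar>a i\<bar> + slack i * f {Suc i..<t}"
    using bound_attained[OF t2] by blast
  moreover have "\<bar>a i\<bar> \<le> 3 * f {i}" using \<tau>_le[of i] f0[of "{i}"] by linarith
  moreover have "slack i * f {Suc i..<t} \<le> 3 * f {Suc i..<t}"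
    using slack_bounds(2) f0 by (rule mult_right_mono)
  \<comment> \<open>The lower estimate for two intervals replaces monotonicity of \<open>f\<close>.
    With \<open>s = 0\<close> its constants are \<open>slack 1 / 2 = 5/4\<close> and
    \<open>slack 0 = 3\<close>, so the factor 12/5 is rounded up to 3.\<close>
  moreover have "f {i} + f {Suc i..<t} \<le> 3 * f {1..<t}"
  proof -
    let ?l = "\<lambda>(c, d :: nat). if c = (0::nat) then i else Suc i"
    let ?r = "\<lambda>(c, d :: nat). if c = (0::nat) then Suc i else t"
    let ?X = "{(0, 0), (1, 0)} :: (nat \<times> nat) set"
    have "slack (Suc 0) / 2 * (\<Sum>x\<in>?X. f {?l x..<?r x}) \<le> slack 0 * f {Suc 0..<t}"
      by (rule fam) (use i in \<open>auto simp: disjoint_family_on_def Q_def\<close>)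
    then have "5/4 * (f {i} + f {Suc i..<t}) \<le> 3 * f {1..<t}" by (simp add: slack_def)
    moreover have "x \<le> 3 * y" if "5/4 * x \<le> 3 * y" "0 \<le> y" for x y :: real
      using that by linarith
    ultimately show ?thesis using f0 by blast
  qed
  ultimately have "norm v \<le> 9 * f {1..<t}" by argo
  then show ?thesis using \<beta> vf by simp
qed

section \<open>Sparse sequences of blocks and distortion\<close>

lemma span_image_atLeast:
  fixes z :: "nat \<Rightarrow> 'a::real_vector"
  assumes "v \<in> span (z ` {k..})"
  shows "\<exists>r\<ge>k. v \<in> span (z ` {k..<r})"
  using assms
proof (induction rule: span_induct_alt)
  case base
  show ?case by (intro exI[of _ k]) (simp add: span_zero)
next
  case (step c x y)
  then obtain i r where i: "x = z i" "k \<le> i" and r: "k \<le> r" "y \<in> span (z ` {k..<r})" by auto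
  let ?r = "max r (Suc i)"
  have "x \<in> span (z ` {k..<?r})" using i by (intro span_base) auto
  moreover have "y \<in> span (z ` {k..<?r})"
    using r(2) span_mono[OF image_mono, of "{k..<r}" "{k..<?r}" z] by auto
  ultimately have "c *\<^sub>R x + y \<in> span (z ` {k..<?r})" by (intro span_add span_scale)
  then show ?case using r(1) by (intro exI[of _ ?r]) auto
qed

text \<open>\<open>S\<close> collects the ratios \<open>N v / norm v\<close> that are reached or
  exceeded arbitrarily far out; it contains \<open>A\<close> and is bounded by \<open>B\<close>. For
  \<beta> in \<open>S\<close> above half the supremum, \<open>2 * \<beta>\<close> is not in
  \<open>S\<close>, and this failure provides the tail starting at \<open>k\<close>.\<close>

lemma almost_maximal_ratio:
  fixes z :: "nat \<Rightarrow> 'a::real_normed_vector"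
  assumes z: "independent_sequence z"
    and AB: "0 < A" "\<And>v. v \<in> span (z ` {1..}) \<Longrightarrow> A * norm v \<le> N v \<and> N v \<le> B * norm v"
  obtains \<beta> k where "0 < \<beta>" "1 \<le> k" "\<And>v. v \<in> span (z ` {k..}) \<Longrightarrow> N v \<le> 2 * \<beta> * norm v"
    "\<And>l. 1 \<le> l \<Longrightarrow> \<exists>v\<in>span (z ` {l..}). v \<noteq> 0 \<and> \<beta> * norm v \<le> N v"
proof -
  define S where "S = {\<beta>. \<forall>l\<ge>1. \<exists>v\<in>span (z ` {l..}). v \<noteq> 0 \<and> \<beta> * norm v \<le> N v}"
  have sub: "span (z ` {l..}) \<subseteq> span (z ` {1..})" if "1 \<le> l" for l
    using that by (intro span_mono image_mono) auto
  have z0: "z l \<noteq> 0" if "1 \<le> l" for l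
    using block_basis_refl[OF z] that by (auto simp: block_sequence_def)
  have AS: "A \<in> S"
    unfolding S_def
  proof (intro CollectI allI impI)
    fix l :: nat assume l: "1 \<le> l"
    have "z l \<in> span (z ` {l..})" by (intro span_base) auto
    then show "\<exists>v\<in>span (z ` {l..}). v \<noteq> 0 \<and> A * norm v \<le> N v"
      using z0[OF l] AB(2) sub[OF l] by blast
  qed
  have "\<beta> \<le> B" if \<beta>S: "\<beta> \<in> S" for \<beta>
  proof -
    obtain v where v: "v \<in> span (z ` {1..})" "v \<noteq> 0" "\<beta> * norm v \<le> N v"
      using \<beta>S by (auto simp: S_def)
    then have "\<beta> * norm v \<le> B * norm v" using AB(2)[OF v(1)] by linarith
    then show ?thesis using v(2) by simp
  qed
  then have bdd: "bdd_above S" by (meson bdd_aboveI)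
  have "A \<le> Sup S" using AS bdd by (rule cSup_upper)
  then have "Sup S / 2 < Sup S" using AB(1) by simp
  then obtain \<beta> where \<beta>: "\<beta> \<in> S" "Sup S / 2 < \<beta>"
    using less_cSupD[of S "Sup S / 2"] AS by blast
  have pos: "0 < \<beta>" using \<beta> \<open>A \<le> Sup S\<close> AB(1) by linarith
  have "2 * \<beta> \<notin> S" using cSup_upper[OF _ bdd, of "2 * \<beta>"] \<beta>(2) by fastforce
  then obtain k where k: "1 \<le> k" "\<And>v. v \<in> span (z ` {k..}) \<Longrightarrow> v \<noteq> 0 \<Longrightarrow> N v < 2 * \<beta> * norm v"
    by (auto simp: S_def not_le)
  show ?thesis
  proof (rule that[OF pos k(1)])
    fix v assume v: "v \<in> span (z ` {k..})"
    show "N v \<le> 2 * \<beta> * norm v"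
    proof (cases "v = 0")
      case True
      then show ?thesis using AB(2)[OF span_zero] by simp
    next
      case False
      then show ?thesis using k(2)[OF v] by simp
    qed
  qed (use \<beta>(1) in \<open>auto simp: S_def\<close>)
qed

text \<open>Good vectors exist in every tail, so they can be chosen recursively. The gap
  \<open>g\<close> may depend on the step and on the end of the block just chosen.\<close>

lemma sparse_blocks:
  fixes z :: "nat \<Rightarrow> 'a::real_normed_vector" and g :: "nat \<Rightarrow> nat \<Rightarrow> nat"
  assumes \<beta>: "\<And>l. 1 \<le> l \<Longrightarrow> \<exists>v\<in>span (z ` {l..}). v \<noteq> 0 \<and> \<beta> * norm v \<le> N v"
    and N: "\<And>r v. v \<in> span (z ` {1..}) \<Longrightarrow> N (r *\<^sub>R v) = \<bar>r\<bar> * N v"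
    and k: "1 \<le> k"
  obtains L R w where "\<And>i. k \<le> L i" "\<And>i. L i \<le> R i" "\<And>i. R i \<le> L (Suc i)"
    "\<And>i. g i (R i) \<le> L (Suc i)" "\<And>i. w i \<in> span (z ` {L i..<R i})"
    "\<And>i. norm (w i) = 1" "\<And>i. \<beta> \<le> N (w i)"
proof -
  let ?P = "\<lambda>(l, r, w). k \<le> l \<and> l \<le> r \<and> w \<in> span (z ` {l..<r}) \<and> norm w = 1 \<and> \<beta> \<le> N w"
  let ?Q = "\<lambda>s (l :: nat, r :: nat, w :: 'a) (l', r' :: nat, w' :: 'a). r \<le> l' \<and> g s r \<le> l'"
  have ex: "\<exists>r w. ?P (l, r, w)" if l: "k \<le> l" for l
  proof -
    have l1: "1 \<le> l" using l k by simp
    then obtain v where v: "v \<in> span (z ` {l..})" "v \<noteq> 0" "\<beta> * norm v \<le> N v" using \<beta> by blast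
    then obtain r where r: "l \<le> r" "v \<in> span (z ` {l..<r})" using span_image_atLeast by blast
    let ?w = "(1 / norm v) *\<^sub>R v"
    have "span (z ` {l..}) \<subseteq> span (z ` {1..})" using l1 by (intro span_mono image_mono) auto
    then have "N ?w = \<bar>1 / norm v\<bar> * N v" using N v(1) by blast
    then have "N ?w = N v / norm v" by simp
    moreover have "\<beta> \<le> N v / norm v" using v(2,3) by (simp add: field_simps)
    ultimately have "\<beta> \<le> N ?w" by simp
    moreover have "?w \<in> span (z ` {l..<r})" using r(2) by (rule span_scale)
    ultimately have "?P (l, r, ?w)" using l r(1) v(2) by simp
    then show ?thesis by blast
  qed
  have "\<exists>f. \<forall>s. ?P (f s) \<and> ?Q s (f s) (f (Suc s))"
  proof (rule dependent_nat_choice)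
    show "\<exists>x. ?P x" using ex[of k] by blast
    fix x s assume "?P x"
    then obtain l r w where x: "x = (l, r, w)" "k \<le> l" "l \<le> r" by (cases x) auto
    let ?l = "max r (g s r)"
    have "k \<le> ?l" using x by simp
    then obtain r' w' where "?P (?l, r', w')" using ex by blast
    then show "\<exists>y. ?P y \<and> ?Q s x y" using x by (intro exI[of _ "(?l, r', w')"]) simp
  qed
  then obtain F where F': "\<forall>s. ?P (F s) \<and> ?Q s (F s) (F (Suc s))" ..
  have F: "?P (F s)" "?Q s (F s) (F (Suc s))" for s
    by (rule F'[THEN spec, THEN conjunct1], rule F'[THEN spec, THEN conjunct2])
  define L where "L s = fst (F s)" for s
  define R where "R s = fst (snd (F s))" for s
  define w where "w s = snd (snd (F s))" for s
  have F_eq: "F s = (L s, R s, w s)" for s by (simp add: L_def R_def w_def)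
  show ?thesis
    by (rule that[of L R w]) (use F in \<open>simp_all add: F_eq\<close>)
qed

section \<open>Infinite-dimensional subspaces and the distortion\<close>

lemma ex_unit_vector:
  assumes "infinite_dim_subspace Y"
  obtains u where "u \<in> Y" "norm u = 1"
proof -
  have Y: "subspace Y" "\<not> (\<exists>B. finite B \<and> span B = Y)" using assms by (auto simp: infinite_dim_subspace_def)
  have "Y \<noteq> {0}"
  proof
    assume "Y = {0}"
    then have "finite {} \<and> span {} = Y" by simp
    then show False using Y(2) by blast
  qed
  moreover have "0 \<in> Y" using Y(1) by (rule subspace_0)
  ultimately obtain y where "y \<in> Y" "y \<noteq> 0" by blast
  then show ?thesis using Y(1) by (intro that[of "(1 / norm y) *\<^sub>R y"]) (auto intro: subspace_scale)
qed

lemma subspace_closed_span: "subspace (closed_span x)"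
  unfolding subspace_def
proof (intro conjI ballI allI)
  show "0 \<in> closed_span x"
    unfolding closed_span_def using closure_subset span_zero by blast
  fix u assume "u \<in> closed_span x"
  then obtain f where f: "\<And>n. f n \<in> span (x ` {1..})" "f \<longlonglongrightarrow> u"
    unfolding closed_span_def closure_sequential by blast
  show "r *\<^sub>R u \<in> closed_span x" for r
    unfolding closed_span_def closure_sequential
    using f by (intro exI[of _ "\<lambda>n. r *\<^sub>R f n"]) (auto intro: span_scale tendsto_intros)
  fix v assume "v \<in> closed_span x"
  then obtain g where g: "\<And>n. g n \<in> span (x ` {1..})" "g \<longlonglongrightarrow> v"
    unfolding closed_span_def closure_sequential by blast
  show "u + v \<in> closed_span x"
    unfolding closed_span_def closure_sequential
    using f g by (intro exI[of _ "\<lambda>n. f n + g n"]) (auto intro: span_add tendsto_intros)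
qed

text \<open>An independent set inside the span of a finite set is finite, whereas the range of
  \<open>w\<close> is infinite.\<close>

lemma closed_span_infinite_dim:
  assumes "independent_sequence w"
  shows "infinite_dim_subspace (closed_span w)"
  unfolding infinite_dim_subspace_def
proof (intro conjI notI)
  show "subspace (closed_span w)" by (rule subspace_closed_span)
  show "closed (closed_span w)" by (simp add: closed_span_def)
  assume "\<exists>B. finite B \<and> span B = closed_span w"
  then obtain B where B: "finite B" "span B = closed_span w" by blast
  have "w ` {1..} \<subseteq> span B"
    unfolding B(2) closed_span_def by (rule order.trans[OF span_superset closure_subset])
  then have "finite (w ` {1..})"
    using independent_span_bound[OF B(1), of "w ` {1..}"] assms by (simp add: independent_sequence_def)
  then have "finite {1 :: nat..}" using assms finite_imageD by (auto simp: independent_sequence_def)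
  then show False by (simp add: infinite_Ici)
qed

text \<open>The infimum is at most its value at \<open>Y\<close> provided that the values are
  bounded below. Each is at least 1: the quotient 1 occurs, and equivalence of the norms bounds the
  quotients by \<open>B / A\<close>.\<close>

lemma distortion_le:
  assumes X: "subspace X" and N: "equivalent_norm_on X N"
    and Y: "Y \<subseteq> X" "infinite_dim_subspace Y"
    and C: "0 < a" "\<And>y. y \<in> Y \<Longrightarrow> a * norm y \<le> N y \<and> N y \<le> C * norm y"
  shows "distortion X N \<le> C / a"
proof -
  let ?R = "\<lambda>Y. {N x / N y |x y. x \<in> Y \<and> y \<in> Y \<and> norm x = 1 \<and> norm y = 1}"
  obtain A B where AB: "0 < A" "\<And>x. x \<in> X \<Longrightarrow> A * norm x \<le> N x \<and> N x \<le> B * norm x"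
    using N unfolding equivalent_norm_on_def by blast
  have ratio: "N x / N y \<le> c / d"
    if "d * norm y \<le> N y" "0 < d" "N x \<le> c * norm x" "norm x = 1" "norm y = 1" "0 \<le> N x" for x y c d
    using that by (intro frac_le) auto
  have "0 \<le> Sup (?R Y)" if YX: "Y \<subseteq> X" "infinite_dim_subspace Y" for Y
  proof -
    obtain u where u: "u \<in> Y" "norm u = 1" using ex_unit_vector[OF YX(2)] .
    have "A \<le> N u" using AB(2)[of u] u YX by auto
    then have "N u / N u = 1" using AB(1) by simp
    then have "1 \<in> ?R Y" using u by force
    moreover have "bdd_above (?R Y)"
    proof (rule bdd_aboveI)
      fix q assume "q \<in> ?R Y"
      then obtain x y where q: "q = N x / N y" "x \<in> X" "y \<in> X" "norm x = 1" "norm y = 1"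
        using YX by blast
      moreover have "0 \<le> N x" using AB(1) AB(2)[OF q(2)] q(4) by simp
      ultimately show "q \<le> B / A" using ratio[of A y x B] AB(1) AB(2)[OF q(2)] AB(2)[OF q(3)] by simp
    qed
    ultimately have "1 \<le> Sup (?R Y)" by (rule cSup_upper)
    then show ?thesis by simp
  qed
  then have "bdd_below ((\<lambda>Y. Sup (?R Y)) ` {Y. Y \<subseteq> X \<and> infinite_dim_subspace Y})"
    by (intro bdd_belowI[of _ 0]) blast
  then have "distortion X N \<le> Sup (?R Y)"
    unfolding distortion_def by (rule cINF_lower) (use Y in simp)
  also have "\<dots> \<le> C / a"
  proof (rule cSup_least)
    obtain u where "u \<in> Y" "norm u = 1" using ex_unit_vector[OF Y(2)] .
    then show "?R Y \<noteq> {}" by blast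
    fix q assume "q \<in> ?R Y"
    then obtain x y where q: "q = N x / N y" "x \<in> Y" "y \<in> Y" "norm x = 1" "norm y = 1" by blast
    moreover have "0 \<le> N x" using C(1) C(2)[OF q(2)] q(4) by simp
    ultimately show "q \<le> C / a" using ratio[of a y x C] C(1) C(2)[OF q(2)] C(2)[OF q(3)] by simp
  qed
  finally show ?thesis .
qed

text \<open>Needed to carry the two-sided estimate from the linear span of the blocks to its
  closure. The Lipschitz constant is \<bar>B\<bar> because the sign of \<open>B\<close> is not
  prescribed.\<close>

lemma equivalent_norm_continuous:
  assumes X: "subspace X" and N: "equivalent_norm_on X N"
  shows "continuous_on X N"
proof -
  obtain A B where AB: "0 < A" "\<And>x. x \<in> X \<Longrightarrow> A * norm x \<le> N x \<and> N x \<le> B * norm x"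
    using N unfolding equivalent_norm_on_def by blast
  have tri: "N (x + y) \<le> N x + N y" if "x \<in> X" "y \<in> X" for x y
    using N that by (auto simp: equivalent_norm_on_def)
  have le: "N x - N y \<le> \<bar>B\<bar> * dist x y" if "x \<in> X" "y \<in> X" for x y
  proof -
    have d: "x - y \<in> X" using X that by (rule subspace_diff)
    have "N x \<le> N (x - y) + N y" using tri[OF d that(2)] by simp
    moreover have "N (x - y) \<le> \<bar>B\<bar> * norm (x - y)"
      using AB(2)[OF d] by (meson abs_ge_self mult_right_mono norm_ge_zero order_trans)
    ultimately show ?thesis by (simp add: dist_norm)
  qed
  have "\<bar>B\<bar>-lipschitz_on X N"
  proof (rule lipschitz_onI)
    fix x y assume "x \<in> X" "y \<in> X"
    then show "dist (N x) (N y) \<le> \<bar>B\<bar> * dist x y"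
      using le[of x y] le[of y x] by (auto simp: dist_real_def dist_commute)
  qed simp
  then show ?thesis by (rule lipschitz_on_continuous_on)
qed

theorem theorem6p2:
  shows "\<exists>D::real. \<forall>(e :: nat \<Rightarrow> 'a::banach) (c :: omega1 \<Rightarrow> nat \<Rightarrow> omega1)
           (x :: nat \<Rightarrow> 'a) (N :: 'a \<Rightarrow> real).
           tsirelson_space e \<longrightarrow> fundamental_sequences c \<longrightarrow> block_basis e x \<longrightarrow>
           equivalent_norm_on (closed_span x) N \<longrightarrow>
           (\<exists>\<gamma> \<in> Delta c x N. \<gamma> 1 = 1/2) \<longrightarrow>
           distortion (closed_span x) N \<le> D"
proof (intro exI[of _ 18] allI impI)
  fix e :: "nat \<Rightarrow> 'a" and c :: "omega1 \<Rightarrow> nat \<Rightarrow> omega1" and x :: "nat \<Rightarrow> 'a" and N :: "'a \<Rightarrow> real"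
  assume e: "tsirelson_space e" and x: "block_basis e x"
    and N: "equivalent_norm_on (closed_span x) N" and "\<exists>\<gamma> \<in> Delta c x N. \<gamma> 1 = 1/2"
  then obtain \<gamma> z where \<gamma>: "\<gamma> 1 = 1/2" and z: "block_basis x z" and stab: "Delta_stabilizes c N z \<gamma>"
    unfolding Delta_def by blast
  obtain \<alpha>\<^sub>x where x': "interval_blocks e \<alpha>\<^sub>x x"
    using block_basis_interval_blocks[OF tsirelson_independent[OF e] x] .
  have x_indep: "independent_sequence x"
    using interval_blocks_independent[OF tsirelson_independent[OF e] x'] .
  obtain \<alpha>\<^sub>z where z': "interval_blocks x \<alpha>\<^sub>z z"
    using block_basis_interval_blocks[OF x_indep z] .
  define \<alpha> where "\<alpha> = \<alpha>\<^sub>x \<circ> \<alpha>\<^sub>z"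
  have ez: "interval_blocks e \<alpha> z" unfolding \<alpha>_def using x' z' by (rule interval_blocks_trans)
  have z_indep: "independent_sequence z" using x_indep z' by (rule interval_blocks_independent)
  let ?X = "closed_span x"
  have X: "subspace ?X" by (rule subspace_closed_span)
  have zX: "span (z ` {1..}) \<subseteq> ?X"
  proof (rule span_minimal[OF _ X])
    have "z ` {1..} \<subseteq> span (x ` {1..})" using z by (auto simp: block_sequence_def)
    then show "z ` {1..} \<subseteq> ?X" unfolding closed_span_def using closure_subset by blast
  qed
  obtain A B where AB: "0 < A" "\<And>v. v \<in> ?X \<Longrightarrow> A * norm v \<le> N v \<and> N v \<le> B * norm v"
    using N unfolding equivalent_norm_on_def by blast
  have scale: "N (r *\<^sub>R v) = \<bar>r\<bar> * N v" if "v \<in> ?X" for r v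
    using N that unfolding equivalent_norm_on_def by blast
  have nonneg: "0 \<le> N v" if "v \<in> ?X" for v
    using AB(2)[OF that] AB(1) by (meson less_imp_le mult_nonneg_nonneg norm_ge_zero order_trans)
  \<comment> \<open>Stabilization is used only at the ordinal 1, where the Schreier family does not
    depend on \<open>c\<close>, and only for tails of \<open>z\<close> themselves.\<close>
  have delta: "\<exists>n\<ge>1. \<eta> < delta schreier1 (tail z n) N" if "\<eta> < 1/2" for \<eta>
  proof -
    obtain \<epsilon> m where \<epsilon>: "\<epsilon> \<longlonglongrightarrow> (0::real)" and m: "\<And>n y. m \<le> n \<Longrightarrow> block_basis (tail z n) y \<Longrightarrow>
        \<bar>delta (schreier c 1) y N - \<gamma> 1\<bar> < \<epsilon> n"
      using stab unfolding Delta_stabilizes_def by metis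
    have "\<forall>\<^sub>F n in sequentially. \<epsilon> n < 1/2 - \<eta>"
      using \<epsilon> that by (intro order_tendstoD(2)) auto
    then obtain n0 where n0: "\<And>n. n0 \<le> n \<Longrightarrow> \<epsilon> n < 1/2 - \<eta>"
      unfolding eventually_sequentially by blast
    define n where "n = max 1 (max m n0)"
    have n: "1 \<le> n" "m \<le> n" "n0 \<le> n" by (simp_all add: n_def)
    have "block_basis (tail z n) (tail z n)"
      using tail_independent[OF z_indep n(1)] by (rule block_basis_refl)
    then have "\<bar>delta schreier1 (tail z n) N - 1/2\<bar> < \<epsilon> n"
      using m[OF n(2)] \<gamma> by (simp add: schreier_one)
    then have "\<eta> < delta schreier1 (tail z n) N" using n0[OF n(3)] by linarith
    then show ?thesis using n(1) by blast
  qed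
  \<comment> \<open>Strict decrease of \<open>slack\<close> puts these thresholds below 1/2.\<close>
  have "\<exists>n\<ge>1. slack (Suc s) / (2 * slack s) < delta schreier1 (tail z n) N" for s
    using slack_less[of s] slack_bounds(1)[of s] by (intro delta) (simp add: field_simps)
  then obtain n where n: "\<And>s. 1 \<le> n s"
    "\<And>s. slack (Suc s) / (2 * slack s) < delta schreier1 (tail z (n s)) N"
    by metis
  have AB_z: "A * norm v \<le> N v \<and> N v \<le> B * norm v" if "v \<in> span (z ` {1..})" for v
    using AB(2) zX that by blast
  obtain \<beta> k where \<beta>: "0 < \<beta>" and k: "1 \<le> k"
    and upper: "\<And>v. v \<in> span (z ` {k..}) \<Longrightarrow> N v \<le> 2 * \<beta> * norm v"
    and large: "\<And>l. 1 \<le> l \<Longrightarrow> \<exists>v\<in>span (z ` {l..}). v \<noteq> 0 \<and> \<beta> * norm v \<le> N v"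
    by (rule almost_maximal_ratio[OF z_indep AB(1) AB_z]) (assumption, rule that)
  have scale_z: "N (r *\<^sub>R v) = \<bar>r\<bar> * N v" if "v \<in> span (z ` {1..})" for r v
    using scale zX that by blast
  obtain L R w where LR: "\<And>i. k \<le> L i" "\<And>i. L i \<le> R i" "\<And>i. R i \<le> L (Suc i)"
    "\<And>i. n i + (8 * \<alpha> (R i) + 9) \<le> L (Suc i)"
    and w: "\<And>i. w i \<in> span (z ` {L i..<R i})" "\<And>i. norm (w i) = 1" "\<And>i. \<beta> \<le> N (w i)"
    \<comment> \<open>The gap accounts both for \<open>n s\<close>, the tail in which the lower
      estimate for step \<open>s\<close> is available, and for the end of the
      \<open>e\<close>-support of the preceding block.\<close>
    using sparse_blocks[OF large scale_z k, of "\<lambda>s r. n s + (8 * \<alpha> r + 9)"] by metis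
  have wk: "w ` {1..} \<subseteq> span (z ` {k..})"
  proof
    fix v assume "v \<in> w ` {1..}"
    then obtain i where i: "v = w i" by blast
    have "span (z ` {L i..<R i}) \<subseteq> span (z ` {k..})"
      using LR(1)[of i] by (intro span_mono image_mono) auto
    then show "v \<in> span (z ` {k..})" using w(1) i by blast
  qed
  have kX: "span (z ` {k..}) \<subseteq> span (z ` {1..})" using k by (intro span_mono image_mono) auto
  have wX: "span (w ` {1..}) \<subseteq> span (z ` {k..})" using wk by (intro span_minimal subspace_span)
  let ?Y = "closed_span w"
  have YX: "?Y \<subseteq> ?X"
    using wX kX zX unfolding closed_span_def by (intro closure_minimal closed_closure) blast+
  have w_blocks: "interval_blocks z (\<lambda>i. if i = 0 then 0 else L i) w"
    unfolding interval_blocks_def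
  proof (intro conjI allI impI)
    have "L i < R i" for i
    proof (rule ccontr)
      assume "\<not> L i < R i"
      then have "w i = 0" using w(1)[of i] by simp
      then show False using w(2)[of i] by simp
    qed
    then have "L i < L (Suc i)" for i using LR(3)[of i] by (meson less_le_trans)
    moreover have "0 < L i" for i using LR(1)[of i] k by linarith
    ultimately show "strict_mono (\<lambda>i. if i = 0 then 0 else L i)" by (simp add: strict_mono_Suc_iff)
    fix i :: nat assume i: "1 \<le> i"
    show "w i \<noteq> 0" using w(2)[of i] by auto
    have "span (z ` {L i..<R i}) \<subseteq> span (z ` {L i..<L (Suc i)})"
      using LR(3)[of i] by (intro span_mono image_mono) auto
    then show "w i \<in> span (z ` {if i = 0 then 0 else L i..<if Suc i = 0 then 0 else L (Suc i)})"
      using w(1)[of i] i by auto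
  qed
  have Y_dim: "infinite_dim_subspace ?Y"
    using interval_blocks_independent[OF z_indep w_blocks] by (rule closed_span_infinite_dim)
  have bounds: "\<beta> * norm v \<le> 9 * N v \<and> N v \<le> 2 * \<beta> * norm v" if v: "v \<in> span (w ` {1..})" for v
  proof
    show "\<beta> * norm v \<le> 9 * N v"
    proof (rule norm_le_on_blocks[OF e ez _ scale_z \<beta> LR(2,3) w _ v])
      show "0 \<le> N v" if "v \<in> span (z ` {1..})" for v using nonneg zX that by blast
      show "\<exists>n\<ge>1. slack (Suc s) / (2 * slack s) < delta schreier1 (tail z n) N \<and>
          n + (8 * \<alpha> (R s) + 9) \<le> L (Suc s)" for s
        using n LR(4) by blast
    qed
    show "N v \<le> 2 * \<beta> * norm v" using upper wX v by blast
  qed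
  \<comment> \<open>By continuity of \<open>N\<close> both inequalities define closed sets, so they
    pass from the span to \<open>?Y\<close>.\<close>
  let ?Z = "{v\<in>?X. \<beta> * norm v \<le> 9 * N v} \<inter> {v\<in>?X. N v \<le> 2 * \<beta> * norm v}"
  have cont: "continuous_on ?X N" using X N by (rule equivalent_norm_continuous)
  have "closed ?Z"
    by (intro closed_Int continuous_on_closed_Collect_le continuous_intros cont)
      (simp_all add: closed_span_def)
  moreover have "span (w ` {1..}) \<subseteq> ?Z" using bounds wX kX zX by blast
  ultimately have YZ: "?Y \<subseteq> ?Z" unfolding closed_span_def[of w] by (intro closure_minimal)
  have "distortion ?X N \<le> 2 * \<beta> / (\<beta> / 9)"
    using X N YX Y_dim
  proof (rule distortion_le)
    show "0 < \<beta> / 9" using \<beta> by simp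
    show "\<beta> / 9 * norm y \<le> N y \<and> N y \<le> 2 * \<beta> * norm y" if "y \<in> ?Y" for y
      using YZ that by auto
  qed
  then show "distortion (closed_span x) N \<le> 18" using \<beta> by simp
qed

end
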